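(* Suppose that the answer to Question A(1/2) is affirmative, i.e., suppose that there is a positive number $s$, not depending on $d$, such that $(1/2,s)$ is a John-Strömberg pair for $\mathcal{Q}(\mathbb{R}^{d})$ for every $d\in\mathbb{N}$. Then, for any such $s$, $$\left(\frac{1}{2}\cdot\frac{2-3s}{2-2s},\;\frac{s}{2}\right)$$ is a John-Strömberg pair for $\mathcal{Q}(\mathbb{R}^{d})$ for all $d\in\mathbb{N}$. Consequently the answer to Question A($\tau,s$) is affirmative, and therefore the answers to Question A and Question J-N are also affirmative.
   Context: A cube in $\mathbb{R}^d$ means a closed cube with sides parallel to the axes, i.e. a cartesian product of $d$ bounded closed intervals, all of the same positive length. $\mathcal{Q}(\mathbb{R}^{d})$ denotes the collection of all cubes in $\mathbb{R}^{d}$, and $\lambda$ denotes $d$-dimensional Lebesgue measure. The dyadic subcubes of $[0,1]^d$ are the cubes $\prod_{j=1}^{d}[(n_j-1)2^{-k},n_j2^{-k}]$ where $k\in\mathbb{N}$ and the integers $n_j$ satisfy $1\le n_j\le 2^k$. A $d$-multi-cube is a non-empty subset of $[0,1]^d$ which is a union of finitely many dyadic subcubes of $[0,1]^d$. John-Strömberg pair: an ordered pair $(\tau,s)$ of positive real numbers is a John-Strömberg pair for $\mathcal{Q}(\mathbb{R}^{d})$ if it has the following property. Let $Q$ be an arbitrary cube in $\mathbb{R}^d$ and let $E_{+}$ and $E_{-}$ be arbitrary disjoint Lebesgue measurable subsets of $Q$ satisfying $\min\{\lambda(E_{+}),\lambda(E_{-})\}>\tau\lambda(Q\setminus E_{+}\setminus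 E_{-})$. Then there exists a cube $W\subset Q$ for which $\min\{\lambda(E_{+}\cap W),\lambda(E_{-}\cap W)\}\ge s\lambda(W)$. Question A(1/2): Does there exist an absolute constant $s>0$ such that, for every positive integer $d$, whenever $E_{+}$ and $E_{-}$ are two disjoint $d$-multi-cubes which satisfy $\min\{\lambda(E_{+}),\lambda(E_{-})\}>\frac12(1-\lambda(E_{+})-\lambda(E_{-}))$, there exists a cube $W\subset[0,1]^d$ for which $\min\{\lambda(W\cap E_{+}),\lambda(W\cap E_{-})\}\ge s\lambda(W)$? Question A($\tau,s$): Do there exist two absolute constants $\tau\in(0,1/2)$ and $s>0$ for which $(\tau,s)$ is a John-Strömberg pair for $\mathcal{Q}(\mathbb{R}^d)$ for every $d\in\mathbb{N}$? Question A: Do there exist two absolute constants $\tau\in(0,1/2)$ and $s>0$ such that, for every positive integer $d$ and every cube $Q$ in $\mathbb{R}^d$, whenever $E_{+}$ and $E_{-}$ are two disjoint measurable subsets of $Q$ with $\min\{\lambda(E_{+}),\lambda(E_{-})\}>\tau\lambda(Q\setminus E_{+}\setminus E_{-})$, there exists a cube $W\subset Q$ for which $\min\{\lambda(W\cap E_{+}),\lambda(W\cap E_{-})\}\ge s\lambda(W)$? Question J-N: Can the constants in the John-Nirenberg inequality for BMO functions of $d$ variables be chosen to be independent of $d$? That is, do there exist absolute constants $B,b>0$ such that for every $d\in\mathbb{N}$, every cube $Q$ in $\mathbb{R}^d$, every integrable $f:Q\to\mathbb{R}$ with $0<\|f\|_{BMO(Q)}<\infty$ and every $\alpha>0$, $$\lambda\left(\{x\in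 Q:|f(x)-f_Q|>\alpha\}\right)\le B\,\lambda(Q)\,e^{-b\alpha/\|f\|_{BMO(Q)}}\,?$$ Here $f_W=\frac{1}{\lambda(W)}\int_W f\,d\lambda$ and $\|f\|_{BMO(Q)}=\sup_W \frac{1}{\lambda(W)}\int_W|f-f_W|\,d\lambda$, the supremum being over all cubes $W\subset Q$. *)

theory Defs
  imports "HOL-Analysis.Analysis"
begin

text \<open>
  The dimension d is quantified inside the statement, so R^d cannot be a type here: its points are
  the extensional functions in \<^term>\<open>PiE {..<d} (\<lambda>_. UNIV :: real set)\<close>. The completion of the
  product of the Borel-Lebesgue measures on the line is d-dimensional Lebesgue measure, so that
  \<^term>\<open>sets (leb d)\<close> consists of all Lebesgue measurable subsets of R^d.
\<close>

definition leb :: "nat \<Rightarrow> (nat \<Rightarrow> real) measure" where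
  "leb d = completion (PiM {..<d} (\<lambda>_. lborel))"

definition cubes :: "nat \<Rightarrow> (nat \<Rightarrow> real) set set" where
  "cubes d = {PiE {..<d} (\<lambda>j. {a j .. a j + l}) | a l. l > 0}"

definition unit_cube :: "nat \<Rightarrow> (nat \<Rightarrow> real) set" where
  "unit_cube d = PiE {..<d} (\<lambda>_. {0..1})"

definition dyadic_subcubes :: "nat \<Rightarrow> (nat \<Rightarrow> real) set set" where
  "dyadic_subcubes d =
     {PiE {..<d} (\<lambda>j. {(real_of_int (n j) - 1) / 2 ^ k .. real_of_int (n j) / 2 ^ k}) | n k.
        k \<ge> (1::nat) \<and> (\<forall>j<d. 1 \<le> n j \<and> n j \<le> 2 ^ k)}"

definition multi_cube :: "nat \<Rightarrow> (nat \<Rightarrow> real) set \<Rightarrow> bool" where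
  "multi_cube d E \<longleftrightarrow>
     E \<noteq> {} \<and> E \<subseteq> unit_cube d \<and> (\<exists>C. finite C \<and> C \<subseteq> dyadic_subcubes d \<and> E = \<Union>C)"

definition John_Stromberg_pair :: "nat \<Rightarrow> real \<Rightarrow> real \<Rightarrow> bool" where
  "John_Stromberg_pair d \<tau> s \<longleftrightarrow>
     \<tau> > 0 \<and> s > 0 \<and>
     (\<forall>Q\<in>cubes d. \<forall>E\<^sub>p\<in>sets (leb d). \<forall>E\<^sub>m\<in>sets (leb d).
        E\<^sub>p \<subseteq> Q \<and> E\<^sub>m \<subseteq> Q \<and> E\<^sub>p \<inter> E\<^sub>m = {} \<and>
        min (measure (leb d) E\<^sub>p) (measure (leb d) E\<^sub>m) > \<tau> * measure (leb d) (Q - E\<^sub>p - E\<^sub>m) \<longrightarrow>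
        (\<exists>W\<in>cubes d. W \<subseteq> Q \<and>
           min (measure (leb d) (E\<^sub>p \<inter> W)) (measure (leb d) (E\<^sub>m \<inter> W)) \<ge> s * measure (leb d) W))"

text \<open>
  Each of the following propositions says that the question of that name has an affirmative answer.
\<close>

definition question_A_half :: bool where
  "question_A_half \<longleftrightarrow>
     (\<exists>s>0. \<forall>d\<ge>1. \<forall>E\<^sub>p E\<^sub>m.
        multi_cube d E\<^sub>p \<and> multi_cube d E\<^sub>m \<and> E\<^sub>p \<inter> E\<^sub>m = {} \<and>
        min (measure (leb d) E\<^sub>p) (measure (leb d) E\<^sub>m)
          > 1 / 2 * (1 - measure (leb d) E\<^sub>p - measure (leb d) E\<^sub>m) \<longrightarrow>
        (\<exists>W\<in>cubes d. W \<subseteq> unit_cube d \<and>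
           min (measure (leb d) (W \<inter> E\<^sub>p)) (measure (leb d) (W \<inter> E\<^sub>m)) \<ge> s * measure (leb d) W))"

definition question_A_tau_s :: bool where
  "question_A_tau_s \<longleftrightarrow>
     (\<exists>\<tau> s. 0 < \<tau> \<and> \<tau> < 1 / 2 \<and> s > 0 \<and> (\<forall>d\<ge>1. John_Stromberg_pair d \<tau> s))"

definition question_A :: bool where
  "question_A \<longleftrightarrow>
     (\<exists>\<tau> s. 0 < \<tau> \<and> \<tau> < 1 / 2 \<and> s > 0 \<and>
        (\<forall>d\<ge>1. \<forall>Q\<in>cubes d. \<forall>E\<^sub>p\<in>sets (leb d). \<forall>E\<^sub>m\<in>sets (leb d).
           E\<^sub>p \<subseteq> Q \<and> E\<^sub>m \<subseteq> Q \<and> E\<^sub>p \<inter> E\<^sub>m = {} \<and>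
           min (measure (leb d) E\<^sub>p) (measure (leb d) E\<^sub>m) > \<tau> * measure (leb d) (Q - E\<^sub>p - E\<^sub>m) \<longrightarrow>
           (\<exists>W\<in>cubes d. W \<subseteq> Q \<and>
              min (measure (leb d) (W \<inter> E\<^sub>p)) (measure (leb d) (W \<inter> E\<^sub>m)) \<ge> s * measure (leb d) W)))"

definition cube_mean :: "nat \<Rightarrow> (nat \<Rightarrow> real) set \<Rightarrow> ((nat \<Rightarrow> real) \<Rightarrow> real) \<Rightarrow> real" where
  "cube_mean d W f = 1 / measure (leb d) W * (LINT x:W|leb d. f x)"

text \<open>
  The supremum may be infinite, hence the type \<^typ>\<open>ennreal\<close>. Only the values of f on Q matter.
\<close>

definition bmo_norm :: "nat \<Rightarrow> (nat \<Rightarrow> real) set \<Rightarrow> ((nat \<Rightarrow> real) \<Rightarrow> real) \<Rightarrow> ennreal" where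
  "bmo_norm d Q f =
     (SUP W\<in>{W\<in>cubes d. W \<subseteq> Q}. ennreal (cube_mean d W (\<lambda>x. \<bar>f x - cube_mean d W f\<bar>)))"

definition question_JN :: bool where
  "question_JN \<longleftrightarrow>
     (\<exists>B>0. \<exists>b>0. \<forall>d\<ge>1. \<forall>Q\<in>cubes d. \<forall>f.
        set_integrable (leb d) Q f \<and> 0 < bmo_norm d Q f \<and> bmo_norm d Q f < \<infinity> \<longrightarrow>
        (\<forall>\<alpha>>0. measure (leb d) {x\<in>Q. \<bar>f x - cube_mean d Q f\<bar> > \<alpha>}
                  \<le> B * measure (leb d) Q * exp (- b * \<alpha> / enn2real (bmo_norm d Q f))))"

end

theory Submission
  imports Defs
begin

text \<open>
  Density s is first improved at the price of one more dimension. Given disjoint compact sets in the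
  unit cube, extend them to cylinders over the unit interval and add, over the part of the cube at
  distance at least \<open>\<delta>\<close> from both, thin alternating stripes of density s/4 to either cylinder. This
  supplies the measure needed to apply the pair (1/2, s). A cube of side at least \<open>\<delta>\<close> sees the
  stripes with density at most s/2, so at least s/2 of the density it provides comes from the original
  sets. A cube of side less than \<open>\<delta>\<close> can only meet stripes of both kinds, and it never sees both of
  them with density s.

  Multi-cubes suffice because dyadic hulls of two disjoint compact sets stay at a positive distance,
  which bounds from below the side of every cube meeting both.

  For the John-Nirenberg inequality, a cube carrying density s of both \<open>{f \<ge> a + M}\<close> and \<open>{f \<le> a}\<close>
  has mean oscillation at least sM/2. For M = 3\<open>\<parallel>f\<parallel>\<close>/s there is no such cube, so the contrapositive of
  the John-Stromberg property bounds the smaller level set, and the distribution function of f decays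
  by a factor of 3 over each interval of length M.
\<close>

subsection \<open>Lebesgue measure in varying dimension\<close>

text \<open>The argument runs mostly on the product before completion, where the theorems on product
  measures apply. By \<open>measure_leb\<close> the completion \<open>leb\<close> assigns the same
  measure to its sets.\<close>

abbreviation borel_leb :: "nat \<Rightarrow> (nat \<Rightarrow> real) measure" where
  "borel_leb d \<equiv> PiM {..<d} (\<lambda>_. lborel)"

interpretation lborel_product: product_sigma_finite "\<lambda>_ :: nat. lborel :: real measure" ..

lemma box_in_sets:
  assumes "\<And>j. j < d \<Longrightarrow> A j \<in> sets borel"
  shows "PiE {..<d} A \<in> sets (borel_leb d)"
  using assms by (intro sets_PiM_I_finite) auto

lemma emeasure_box:
  assumes "\<And>j. j < d \<Longrightarrow> A j \<in> sets borel"
  shows "emeasure (borel_leb d) (PiE {..<d} A) = (\<Prod>j<d. emeasure lborel (A j))"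
  using assms by (intro lborel_product.emeasure_PiM) auto

lemma emeasure_cube:
  assumes "l \<ge> 0"
  shows "emeasure (borel_leb d) (PiE {..<d} (\<lambda>j. {a j .. a j + l})) = ennreal (l ^ d)"
  using assms by (subst emeasure_box) (auto simp: prod_ennreal ennreal_power)

lemma cubesE:
  assumes "Q \<in> cubes d"
  obtains a l where "l > 0" "Q = PiE {..<d} (\<lambda>j. {a j .. a j + l})"
    "Q \<in> sets (borel_leb d)" "measure (borel_leb d) Q = l ^ d"
    "emeasure (borel_leb d) Q = ennreal (l ^ d)"
proof -
  from assms obtain a l where al: "l > 0" "Q = PiE {..<d} (\<lambda>j. {a j .. a j + l})"
    unfolding cubes_def by blast
  moreover have "Q \<in> sets (borel_leb d)"
    unfolding al by (rule box_in_sets) auto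
  moreover have "emeasure (borel_leb d) Q = ennreal (l ^ d)"
    unfolding al using al(1) by (intro emeasure_cube) auto
  moreover from this have "measure (borel_leb d) Q = l ^ d"
    using al(1) by (simp add: measure_def)
  ultimately show ?thesis using that by blast
qed

lemma measure_leb: "A \<in> sets (borel_leb d) \<Longrightarrow> measure (leb d) A = measure (borel_leb d) A"
  unfolding leb_def by (rule measure_completion)

lemma cube_in_sets: "Q \<in> cubes d \<Longrightarrow> Q \<in> sets (borel_leb d)"
  by (erule cubesE)

lemma sets_leb: "A \<in> sets (borel_leb d) \<Longrightarrow> A \<in> sets (leb d)"
  unfolding leb_def by simp

lemma cube_fmeasurable: "Q \<in> cubes d \<Longrightarrow> Q \<in> fmeasurable (borel_leb d)"
  by (erule cubesE) (simp add: fmeasurable_def)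

lemma cube_fmeasurable_leb: "Q \<in> cubes d \<Longrightarrow> Q \<in> fmeasurable (leb d)"
  using cube_fmeasurable[of Q d] unfolding leb_def fmeasurable_def by auto

lemma measure_cube_pos: "Q \<in> cubes d \<Longrightarrow> measure (leb d) Q > 0"
  by (erule cubesE) (simp add: measure_leb)

lemma unit_cube_in_cubes: "unit_cube d \<in> cubes d"
  unfolding unit_cube_def cubes_def by (rule CollectI, rule exI[of _ "\<lambda>_. 0"], rule exI[of _ 1]) simp

lemma measure_unit_cube: "measure (borel_leb d) (unit_cube d) = 1"
  using emeasure_cube[of 1 d "\<lambda>_. 0"] unfolding unit_cube_def by (simp add: measure_def)

section \<open>Borel and compact sets of the sequence space, and inner regularity\<close>

lemma space_borel_leb: "space (borel_leb d) = PiE {..<d} (\<lambda>_. UNIV)"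
  by (simp add: space_PiM)

text \<open>Points of R^d are sequences with the constant value \<open>undefined\<close> from index
  \<open>d\<close> on, so the identity is measurable coordinate by coordinate. This makes the
  topology of \<open>nat \<Rightarrow> real\<close> available for subsets of R^d.\<close>

lemma id_measurable_borel: "(\<lambda>x. x) \<in> measurable (borel_leb d) borel"
proof (rule measurable_coordinatewise_then_product)
  fix i
  show "(\<lambda>x. x i) \<in> borel_measurable (borel_leb d)"
  proof (cases "i < d")
    case True
    then show ?thesis
      using measurable_component_singleton[of i "{..<d}" "\<lambda>_. lborel"] by simp
  next
    case False
    then have "x i = undefined" if "x \<in> space (borel_leb d)" for x
      using that by (auto simp: space_borel_leb PiE_def extensional_def)
    then show ?thesis
      by (subst measurable_cong[where g="\<lambda>_. undefined"]) auto
  qed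
qed

lemma borel_Int_space: "B \<in> sets borel \<Longrightarrow> B \<inter> space (borel_leb d) \<in> sets (borel_leb d)"
  using measurable_sets[OF id_measurable_borel] by simp

lemma borel_subset_space: "B \<in> sets borel \<Longrightarrow> B \<subseteq> space (borel_leb d) \<Longrightarrow> B \<in> sets (borel_leb d)"
  using borel_Int_space[of B d] by (simp add: Int_absorb2)

lemma restrict_measurable_borel:
  "(\<lambda>x. restrict x {..<d}) \<in> measurable (borel :: (nat \<Rightarrow> real) measure) (borel_leb d)"
  by (rule measurable_restrict) (simp add: borel_measurable_continuous_onI continuous_on_product_coordinates)

lemma closed_space_borel_leb: "closed (space (borel_leb d))"
proof -
  have "space (borel_leb d) = (\<Inter>i\<in>{d..}. {x. x i = undefined})"
    by (auto simp: space_borel_leb PiE_def extensional_def)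
  moreover have "closed {x :: nat \<Rightarrow> real. x i = undefined}" for i
    by (intro closed_Collect_eq continuous_on_product_coordinates continuous_on_const)
  ultimately show ?thesis by auto
qed

text \<open>Restriction to the first \<open>d\<close> coordinates fixes every point of the space.
  Hence \<open>B\<close> is its own preimage under this Borel map, cut down to a closed set.\<close>

lemma sets_borel_leb_imp_borel:
  assumes "B \<in> sets (borel_leb d)" shows "B \<in> sets borel"
proof -
  have "B = ((\<lambda>x. restrict x {..<d}) -` B \<inter> space borel) \<inter> space (borel_leb d)"
    using sets.sets_into_space[OF assms]
    by (auto simp: space_borel_leb PiE_def extensional_restrict Int_def)
  also have "\<dots> \<in> sets borel"
    using measurable_sets[OF restrict_measurable_borel assms] closed_space_borel_leb[of d] by auto
  finally show ?thesis .
qed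

text \<open>The measure restricted to \<open>B\<close> is finite and is carried by \<open>M\<close>
  to a Borel measure on the Polish space of all real sequences, where inner regularity holds. A
  compact subset of \<open>B\<close> there is a measurable subset of R^d with the same
  measure.\<close>

lemma compact_inner_approximation:
  assumes B: "B \<in> sets (borel_leb d)" "emeasure (borel_leb d) B < \<infinity>" and "e > 0"
  obtains K where "compact K" "K \<subseteq> B" "K \<in> sets (borel_leb d)"
    "measure (borel_leb d) K > measure (borel_leb d) B - e"
proof -
  define M where "M = distr (restrict_space (borel_leb d) B) borel (\<lambda>x. x)"
  have mid[measurable]: "(\<lambda>x. x) \<in> measurable (restrict_space (borel_leb d) B) borel"
    by (rule measurable_restrict_space1) (rule id_measurable_borel)
  have sp: "B \<inter> space (borel_leb d) = B"
    using sets.sets_into_space[OF B(1)] by auto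
  have em: "emeasure M A = emeasure (borel_leb d) (A \<inter> B)" if "A \<in> sets borel" for A
    unfolding M_def using that B(1) sets.sets_into_space[OF B(1)]
    by (subst emeasure_distr[OF mid])
       (auto simp: emeasure_restrict_space space_restrict_space Int_assoc sp intro!: arg_cong[where f="emeasure _"])
  have B': "B \<in> sets borel" by (rule sets_borel_leb_imp_borel[OF B(1)])
  have "emeasure M B = (SUP K\<in>{K. K \<subseteq> B \<and> compact K}. emeasure M K)"
  proof (rule inner_regular)
    show "sets M = sets borel" by (simp add: M_def)
    show "emeasure M (space M) \<noteq> \<infinity>"
      using em[of UNIV] B(2) by (simp add: M_def)
  qed (use B' in simp)
  then have sup: "emeasure (borel_leb d) B = (SUP K\<in>{K. K \<subseteq> B \<and> compact K}. emeasure M K)"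
    using em[OF B'] by simp
  have "\<exists>K\<in>{K. K \<subseteq> B \<and> compact K}. ennreal (measure (borel_leb d) B - e) < emeasure M K"
    if "measure (borel_leb d) B - e \<ge> 0"
    unfolding less_SUP_iff[symmetric] sup[symmetric]
    using B(2) that \<open>e > 0\<close> by (subst emeasure_eq_ennreal_measure) (auto simp: ennreal_less_iff)
  moreover have meas: "K \<in> sets (borel_leb d)" and emK: "emeasure M K = ennreal (measure (borel_leb d) K)"
    if "K \<subseteq> B" "compact K" for K
  proof -
    have Kb: "K \<in> sets borel" using that(2) by (simp add: compact_imp_closed)
    show K: "K \<in> sets (borel_leb d)"
      using Kb that(1) sets.sets_into_space[OF B(1)] by (intro borel_subset_space) auto
    have "emeasure (borel_leb d) K \<le> emeasure (borel_leb d) B"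
      using that(1) B(1) by (rule emeasure_mono)
    then have "emeasure (borel_leb d) K \<noteq> \<infinity>" using B(2) by auto
    then show "emeasure M K = ennreal (measure (borel_leb d) K)"
      using em[OF Kb] that(1) by (simp add: Int_absorb2 emeasure_eq_ennreal_measure)
  qed
  show ?thesis
  \<comment> \<open>\<open>ennreal\<close> sends negative numbers to 0, so a loss \<open>e\<close>
    above the measure of \<open>B\<close> is treated apart; the empty set then suffices.\<close>
  proof (cases "measure (borel_leb d) B - e \<ge> 0")
    case True
    then obtain K where K: "K \<subseteq> B" "compact K" "ennreal (measure (borel_leb d) B - e) < emeasure M K"
      using calculation by blast
    with emK[OF K(1,2)] True have "measure (borel_leb d) B - e < measure (borel_leb d) K"
      by (simp add: ennreal_less_iff)
    with K meas that show ?thesis by blast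
  next
    case False
    then show ?thesis using that[of "{}"] by simp
  qed
qed

text \<open>The sum of the coordinate distances is continuous and attains its minimum on
  \<open>K \<times> L\<close>. The minimum is positive because extensional points that agree in the
  first \<open>d\<close> coordinates are equal.\<close>

lemma compact_separation:
  assumes "compact K" "compact L" "K \<inter> L = {}"
    and "K \<subseteq> space (borel_leb d)" "L \<subseteq> space (borel_leb d)"
  obtains \<delta> where "\<delta> > 0" "\<And>x y. x \<in> K \<Longrightarrow> y \<in> L \<Longrightarrow> \<exists>i<d. \<delta> \<le> \<bar>x i - y i\<bar>"
proof (cases "K \<times> L = {}")
  case True
  then show ?thesis using that[of 1] by auto
next
  case False
  define h :: "(nat \<Rightarrow> real) \<times> (nat \<Rightarrow> real) \<Rightarrow> real" where "h = (\<lambda>p. \<Sum>i<d. \<bar>fst p i - snd p i\<bar>)"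
  have "continuous_on (K \<times> L) (\<lambda>p :: (nat \<Rightarrow> real) \<times> (nat \<Rightarrow> real). fst p i)"
       "continuous_on (K \<times> L) (\<lambda>p :: (nat \<Rightarrow> real) \<times> (nat \<Rightarrow> real). snd p i)" for i
    by (rule continuous_on_compose2[OF continuous_on_product_coordinates[of i]], auto intro: continuous_intros)+
  then have "continuous_on (K \<times> L) h"
    unfolding h_def by (intro continuous_intros)
  then obtain p where p: "p \<in> K \<times> L" "\<And>q. q \<in> K \<times> L \<Longrightarrow> h p \<le> h q"
    using continuous_attains_inf[OF compact_Times[OF assms(1,2)] False] by metis
  have pos: "h p > 0"
  proof (rule ccontr)
    assume "\<not> h p > 0"
    moreover have "h p \<ge> 0" unfolding h_def by (intro sum_nonneg) auto
    ultimately have "h p = 0" by simp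
    then have "\<forall>i<d. fst p i = snd p i"
      unfolding h_def by (subst (asm) sum_nonneg_eq_0_iff) auto
    moreover have "fst p \<in> extensional {..<d}" "snd p \<in> extensional {..<d}"
      using p(1) assms(4,5) by (auto simp: space_borel_leb PiE_def)
    ultimately have "fst p = snd p"
      by (intro extensionalityI[of _ "{..<d}"]) auto
    with p(1) assms(3) show False by auto
  qed
  show ?thesis
  \<comment> \<open>If all \<open>d\<close> coordinate distances were below this value, their sum
    would be below the minimum; \<open>d + 1\<close> instead of \<open>d\<close> gives strictness
    and avoids division by zero.\<close>
  proof (rule that[of "h p / (real d + 1)"])
    show "h p / (real d + 1) > 0" using pos by simp
    fix x y assume xy: "x \<in> K" "y \<in> L"
    show "\<exists>i<d. h p / (real d + 1) \<le> \<bar>x i - y i\<bar>"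
    proof (rule ccontr)
      assume "\<not> ?thesis"
      then have "h (x, y) \<le> (\<Sum>i<d. h p / (real d + 1))"
        unfolding h_def by (intro sum_mono) (auto simp: not_le less_imp_le)
      also have "\<dots> < h p"
        using pos by (simp add: field_simps)
      finally show False using p(2)[of "(x, y)"] xy by simp
    qed
  qed
qed

text \<open>The open neighbourhood of radius \<open>\<delta>\<close> in the sup norm, cut down to
  the unit cube so that its measure is finite. The sup norm fits cubes: two points of a cube differ
  by at most its side in each coordinate.\<close>

definition sup_nbhd :: "nat \<Rightarrow> real \<Rightarrow> (nat \<Rightarrow> real) set \<Rightarrow> (nat \<Rightarrow> real) set" where
  "sup_nbhd d \<delta> K = {x \<in> unit_cube d. \<exists>y\<in>K. \<forall>i<d. \<bar>x i - y i\<bar> < \<delta>}"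

lemma unit_cube_in_sets: "unit_cube d \<in> sets (borel_leb d)"
  by (rule cube_in_sets[OF unit_cube_in_cubes])

lemma unit_cube_subset_space: "unit_cube d \<subseteq> space (borel_leb d)"
  by (rule sets.sets_into_space[OF unit_cube_in_sets])

lemma sup_nbhd_in_sets: "sup_nbhd d \<delta> K \<in> sets (borel_leb d)"
proof -
  have "open (\<Union>y\<in>K. \<Inter>i<d. {x :: nat \<Rightarrow> real. \<bar>x i - y i\<bar> < \<delta>})"
    by (intro open_UN ballI open_INT open_Collect_less continuous_intros continuous_on_product_coordinates) auto
  then have "(\<Union>y\<in>K. \<Inter>i<d. {x :: nat \<Rightarrow> real. \<bar>x i - y i\<bar> < \<delta>}) \<inter> space (borel_leb d) \<in> sets (borel_leb d)"
    by (intro borel_Int_space) auto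
  then have "unit_cube d \<inter> ((\<Union>y\<in>K. \<Inter>i<d. {x :: nat \<Rightarrow> real. \<bar>x i - y i\<bar> < \<delta>}) \<inter> space (borel_leb d)) \<in> sets (borel_leb d)"
    by (rule sets.Int[OF unit_cube_in_sets])
  also have "unit_cube d \<inter> ((\<Union>y\<in>K. \<Inter>i<d. {x :: nat \<Rightarrow> real. \<bar>x i - y i\<bar> < \<delta>}) \<inter> space (borel_leb d)) = sup_nbhd d \<delta> K"
    using unit_cube_subset_space[of d] unfolding sup_nbhd_def by auto
  finally show ?thesis .
qed

lemma fmeasurable_unit_cube_subset:
  "A \<in> sets (borel_leb d) \<Longrightarrow> A \<subseteq> unit_cube d \<Longrightarrow> A \<in> fmeasurable (borel_leb d)"
  using cube_fmeasurable[OF unit_cube_in_cubes] by (metis fmeasurableI2)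

text \<open>The neighbourhoods of radius \<open>1 / (n + 1)\<close> decrease to \<open>K\<close>,
  since a point outside the compact set \<open>K\<close> keeps a positive distance from it.
  Continuity of the measure from above does the rest.\<close>

lemma measure_sup_nbhd_small:
  assumes K: "compact K" "K \<subseteq> unit_cube d" and "e > 0"
  obtains \<eta> where "\<eta> > 0"
    "\<And>\<delta>. \<delta> \<le> \<eta> \<Longrightarrow> measure (borel_leb d) (sup_nbhd d \<delta> K) < measure (borel_leb d) K + e"
proof -
  define A where "A n = sup_nbhd d (1 / real (Suc n)) K" for n
  have mono: "sup_nbhd d \<delta> K \<subseteq> sup_nbhd d \<epsilon> K" if "\<delta> \<le> \<epsilon>" for \<delta> \<epsilon>
    unfolding sup_nbhd_def using that by force
  have int: "(\<Inter>n. A n) = K"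
  proof (intro equalityI subsetI)
    fix x assume "x \<in> (\<Inter>n. A n)"
    then have xA: "x \<in> A n" for n by auto
    then have xu: "x \<in> unit_cube d" by (auto simp: A_def sup_nbhd_def)
    show "x \<in> K"
    proof (rule ccontr)
      assume "x \<notin> K"
      moreover have "{x} \<subseteq> space (borel_leb d)" "K \<subseteq> space (borel_leb d)"
        using xu K(2) unit_cube_subset_space by blast+
      ultimately obtain \<delta> where \<delta>: "\<delta> > 0" "\<And>x' y. x' \<in> {x} \<Longrightarrow> y \<in> K \<Longrightarrow> \<exists>i<d. \<delta> \<le> \<bar>x' i - y i\<bar>"
        using compact_separation[of "{x}" K d] K(1) by auto
      obtain n where n: "1 / real (Suc n) < \<delta>"
        using nat_approx_posE[OF \<delta>(1)] by auto
      from xA[of n] obtain y where "y \<in> K" "\<forall>i<d. \<bar>x i - y i\<bar> < 1 / real (Suc n)"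
        by (auto simp: A_def sup_nbhd_def)
      with \<delta>(2)[of x y] n show False by fastforce
    qed
  next
    fix x assume "x \<in> K"
    then show "x \<in> (\<Inter>n. A n)"
      using K(2) by (auto simp: A_def sup_nbhd_def intro!: bexI[of _ x])
  qed
  have "(\<lambda>n. measure (borel_leb d) (A n)) \<longlonglongrightarrow> measure (borel_leb d) (\<Inter>n. A n)"
  proof (rule Lim_measure_decseq)
    show "range A \<subseteq> sets (borel_leb d)" by (auto simp: A_def sup_nbhd_in_sets)
    show "decseq A" unfolding decseq_def A_def by (auto intro!: mono simp: field_simps)
    fix n
    have "A n \<in> fmeasurable (borel_leb d)"
      unfolding A_def by (rule fmeasurable_unit_cube_subset[OF sup_nbhd_in_sets]) (auto simp: sup_nbhd_def)
    then show "emeasure (borel_leb d) (A n) \<noteq> \<infinity>" by (auto simp: fmeasurable_def)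
  qed
  then have "\<forall>\<^sub>F n in sequentially. measure (borel_leb d) (A n) < measure (borel_leb d) K + e"
    unfolding int using \<open>e > 0\<close> by (intro order_tendstoD) auto
  then obtain n where n: "measure (borel_leb d) (A n) < measure (borel_leb d) K + e"
    by (auto simp: eventually_sequentially)
  show ?thesis
  proof (rule that[of "1 / real (Suc n)"])
    fix \<delta> :: real assume "\<delta> \<le> 1 / real (Suc n)"
    then have "measure (borel_leb d) (sup_nbhd d \<delta> K) \<le> measure (borel_leb d) (A n)"
      unfolding A_def
      by (intro measure_mono_fmeasurable mono sup_nbhd_in_sets fmeasurable_unit_cube_subset)
         (auto simp: sup_nbhd_def)
    with n show "measure (borel_leb d) (sup_nbhd d \<delta> K) < measure (borel_leb d) K + e" by simp
  qed simp
qed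

subsection \<open>Reduction to compact subsets of the unit cube\<close>

text \<open>For \<open>l > 0\<close> it carries the unit cube onto the cube with corner
  \<open>a\<close> and side \<open>l\<close>. The restriction keeps values extensional, and the
  inverse on the space is again an \<open>affine_map\<close>.\<close>

definition affine_map :: "nat \<Rightarrow> (nat \<Rightarrow> real) \<Rightarrow> real \<Rightarrow> (nat \<Rightarrow> real) \<Rightarrow> nat \<Rightarrow> real" where
  "affine_map d a l x = (\<lambda>i\<in>{..<d}. a i + l * x i)"

lemma affine_map_measurable: "affine_map d a l \<in> measurable (borel_leb d) (borel_leb d)"
  unfolding affine_map_def by (intro measurable_restrict) simp

lemma affine_map_in_space: "affine_map d a l x \<in> space (borel_leb d)"
  by (simp add: affine_map_def space_borel_leb)

lemma affine_map_inverse: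
  assumes "l \<noteq> 0" "x \<in> space (borel_leb d)"
  shows "affine_map d (\<lambda>i. - (a i / l)) (1 / l) (affine_map d a l x) = x"
proof (rule extensionalityI[of _ "{..<d}"])
  show "x \<in> extensional {..<d}" using assms(2) by (simp add: space_borel_leb PiE_def)
qed (use assms(1) in \<open>auto simp: affine_map_def field_simps\<close>)

text \<open>The image measure scaled by \<open>l ^ d\<close> agrees with the product measure on
  boxes, by the scaling of \<open>lborel\<close> in each coordinate; a product measure is determined
  by its values on boxes.\<close>

lemma emeasure_affine_map_vimage:
  assumes "l > 0" "B \<in> sets (borel_leb d)"
  shows "emeasure (borel_leb d) B
    = ennreal (l ^ d) * emeasure (borel_leb d) (affine_map d a l -` B \<inter> space (borel_leb d))"
proof -
  let ?P = "scale_measure (ennreal (l ^ d)) (distr (borel_leb d) (borel_leb d) (affine_map d a l))"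
  have "?P = borel_leb d"
  proof (rule lborel_product.PiM_eqI)
    fix A :: "nat \<Rightarrow> real set" assume A: "\<And>i. i \<in> {..<d} \<Longrightarrow> A i \<in> sets lborel"
    have 1: "emeasure lborel (A i) = ennreal l * emeasure lborel ((\<lambda>t. a i + l * t) -` A i)"
      if "i < d" for i
    proof -
      have [measurable]: "A i \<in> sets borel" using A[of i] that by simp
      show ?thesis
        using assms(1)
        by (subst lborel_real_affine[of l "a i"])
           (simp_all add: emeasure_density nn_integral_cmult emeasure_distr)
    qed
    have "affine_map d a l -` PiE {..<d} A \<inter> space (borel_leb d) = PiE {..<d} (\<lambda>i. (\<lambda>t. a i + l * t) -` A i)"
      by (auto simp: space_borel_leb affine_map_def PiE_iff)
    then have "emeasure ?P (PiE {..<d} A)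
      = ennreal (l ^ d) * emeasure (borel_leb d) (PiE {..<d} (\<lambda>i. (\<lambda>t. a i + l * t) -` A i))"
      using A box_in_sets[of d A] by (simp add: emeasure_distr affine_map_measurable)
    also have "\<dots> = ennreal (l ^ d) * (\<Prod>i<d. emeasure lborel ((\<lambda>t. a i + l * t) -` A i))"
    proof (subst emeasure_box)
      fix j assume "j < d"
      then have [measurable]: "A j \<in> sets borel" using A[of j] by simp
      show "(\<lambda>t. a j + l * t) -` A j \<in> sets borel"
        using measurable_sets[of "\<lambda>t. a j + l * t" borel borel "A j"] by simp
    qed simp
    also have "\<dots> = (\<Prod>i<d. emeasure lborel (A i))"
      using 1 assms(1) by (simp add: prod.distrib ennreal_power)
    finally show "emeasure ?P (PiE {..<d} A) = (\<Prod>i\<in>{..<d}. emeasure lborel (A i))" .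
  qed auto
  then have "emeasure (borel_leb d) B = emeasure ?P B" by simp
  also have "\<dots> = ennreal (l ^ d) * emeasure (borel_leb d) (affine_map d a l -` B \<inter> space (borel_leb d))"
    using assms(2) by (simp add: emeasure_distr affine_map_measurable)
  finally show ?thesis .
qed

lemma measure_affine_map_vimage:
  assumes "l > 0" "B \<in> sets (borel_leb d)"
  shows "measure (borel_leb d) B
    = l ^ d * measure (borel_leb d) (affine_map d a l -` B \<inter> space (borel_leb d))"
  using emeasure_affine_map_vimage[OF assms, of a] assms(1)
  by (simp add: measure_def enn2real_mult)

lemma affine_map_vimage_cube:
  assumes "W \<in> cubes d" "l > 0"
  shows "affine_map d a l -` W \<inter> space (borel_leb d) \<in> cubes d"
proof -
  from assms(1) obtain b m where W: "m > 0" "W = PiE {..<d} (\<lambda>j. {b j .. b j + m})"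
    by (rule cubesE)
  have *: "b \<le> a + l * t \<and> a + l * t \<le> b + m \<longleftrightarrow> (b - a) / l \<le> t \<and> t \<le> (b - a) / l + m / l"
    for a b t :: real
    using assms(2) by (auto simp: field_simps)
  have "affine_map d a l -` W \<inter> space (borel_leb d)
    = PiE {..<d} (\<lambda>j. {(b j - a j) / l .. (b j - a j) / l + m / l})"
    unfolding W by (rule set_eqI) (simp add: space_borel_leb affine_map_def PiE_iff * cong: conj_cong)
  then show ?thesis
    unfolding cubes_def using W(1) assms(2)
    by (intro CollectI exI[of _ "\<lambda>j. (b j - a j) / l"] exI[of _ "m / l"]) auto
qed

lemma compact_in_borel_leb: "compact K \<Longrightarrow> K \<subseteq> unit_cube d \<Longrightarrow> K \<in> sets (borel_leb d)"
  using unit_cube_subset_space[of d] by (intro borel_subset_space) (auto simp: compact_imp_closed)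

lemma leb_Diff_measure:
  assumes Q: "Q \<in> cubes d" and E: "Ep \<in> sets (leb d)" "Em \<in> sets (leb d)" "Ep \<subseteq> Q" "Em \<subseteq> Q" "Ep \<inter> Em = {}"
  shows "measure (leb d) (Q - Ep - Em) = measure (leb d) Q - measure (leb d) Ep - measure (leb d) Em"
proof -
  have fin: "Q \<in> fmeasurable (leb d)" using Q by (rule cube_fmeasurable_leb)
  then have "Ep \<in> fmeasurable (leb d)" "Em \<in> fmeasurable (leb d)"
    using E by (metis fmeasurableI2)+
  then show ?thesis
    using fin E by (subst measurable_measure_Diff; (subst measurable_measure_Diff)?) auto
qed

text \<open>A set of the completion is its \<open>main_part\<close>, measurable before completion,
  together with a part of a null set.\<close>

lemma leb_Borel_kernel:
  assumes "E \<in> sets (leb d)"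
  obtains B where "B \<in> sets (borel_leb d)" "B \<subseteq> E" "measure (borel_leb d) B = measure (leb d) E"
proof (rule that)
  show "main_part (borel_leb d) E \<in> sets (borel_leb d)" using assms unfolding leb_def by simp
  show "main_part (borel_leb d) E \<subseteq> E"
    using main_part_null_part_Un[of E "borel_leb d"] assms unfolding leb_def by blast
  show "measure (borel_leb d) (main_part (borel_leb d) E) = measure (leb d) E"
    using assms unfolding leb_def by (simp add: measure_def)
qed

text \<open>
  Lebesgue sets are replaced by Borel kernels, these are pulled back to the unit cube, and there
  inner regularity applies; the strict inequality leaves room for the small loss of measure.
\<close>

lemma John_Stromberg_pairI_compact:
  assumes pos: "\<tau> > 0" "s > 0"
    and H: "\<And>Kp Km. compact Kp \<Longrightarrow> compact Km \<Longrightarrow> Kp \<subseteq> unit_cube d \<Longrightarrow> Km \<subseteq> unit_cube d \<Longrightarrow> Kp \<inter> Km = {} \<Longrightarrow>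
      \<tau> * (1 - measure (borel_leb d) Kp - measure (borel_leb d) Km)
        < min (measure (borel_leb d) Kp) (measure (borel_leb d) Km) \<Longrightarrow>
      \<exists>W\<in>cubes d. W \<subseteq> unit_cube d \<and>
        s * measure (borel_leb d) W
          \<le> min (measure (borel_leb d) (Kp \<inter> W)) (measure (borel_leb d) (Km \<inter> W))"
  shows "John_Stromberg_pair d \<tau> s"
  unfolding John_Stromberg_pair_def
proof (intro conjI pos ballI impI, elim conjE)
  let ?\<mu> = "measure (borel_leb d)"
  fix Q Ep Em
  assume Q: "Q \<in> cubes d" and E: "Ep \<in> sets (leb d)" "Em \<in> sets (leb d)"
    and sub: "Ep \<subseteq> Q" "Em \<subseteq> Q" and disj: "Ep \<inter> Em = {}"
    and big: "min (measure (leb d) Ep) (measure (leb d) Em) > \<tau> * measure (leb d) (Q - Ep - Em)"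
  from Q obtain a l where al: "l > 0" "Q = PiE {..<d} (\<lambda>j. {a j .. a j + l})"
    "Q \<in> sets (borel_leb d)" "?\<mu> Q = l ^ d"
    by (rule cubesE)
  define T where "T = affine_map d a l"
  define pull where "pull B = T -` B \<inter> space (borel_leb d)" for B
  have pull_sets: "pull B \<in> sets (borel_leb d)" if "B \<in> sets (borel_leb d)" for B
    unfolding pull_def T_def by (rule measurable_sets[OF affine_map_measurable that])
  have pull_measure: "?\<mu> B = l ^ d * ?\<mu> (pull B)" if "B \<in> sets (borel_leb d)" for B
    unfolding pull_def T_def by (rule measure_affine_map_vimage[OF al(1) that])
  have pull_Q: "pull Q \<subseteq> unit_cube d"
  proof
    fix x assume x: "x \<in> pull Q"
    have "0 \<le> t \<and> t \<le> 1" if "b \<le> b + l * t" "b + l * t \<le> b + l" for b t :: real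
      using that al(1) by (auto simp: zero_le_mult_iff)
    with x show "x \<in> unit_cube d"
      unfolding pull_def T_def al(2) unit_cube_def
      by (simp add: affine_map_def space_borel_leb PiE_iff)
  qed
  from E(1) obtain Bp where Bp: "Bp \<in> sets (borel_leb d)" "Bp \<subseteq> Ep" "?\<mu> Bp = measure (leb d) Ep"
    by (rule leb_Borel_kernel)
  from E(2) obtain Bm where Bm: "Bm \<in> sets (borel_leb d)" "Bm \<subseteq> Em" "?\<mu> Bm = measure (leb d) Em"
    by (rule leb_Borel_kernel)
  have subu: "pull Bp \<subseteq> unit_cube d" "pull Bm \<subseteq> unit_cube d"
    using pull_Q Bp(2) Bm(2) sub unfolding pull_def by blast+
  have l: "l ^ d > 0" using al(1) by simp
  \<comment> \<open>\<open>m\<close> is the slack of the strict hypothesis after rescaling to the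
    unit cube.\<close>
  define m where "m = min (?\<mu> (pull Bp)) (?\<mu> (pull Bm)) - \<tau> * (1 - ?\<mu> (pull Bp) - ?\<mu> (pull Bm))"
  have "l ^ d * m = min (?\<mu> Bp) (?\<mu> Bm) - \<tau> * (?\<mu> Q - ?\<mu> Bp - ?\<mu> Bm)"
    unfolding m_def using pull_measure[OF Bp(1)] pull_measure[OF Bm(1)] al(4) l
    by (simp add: min_mult_distrib_left algebra_simps)
  also have "\<dots> > 0"
    using big leb_Diff_measure[OF Q E sub disj] Bp(3) Bm(3) measure_leb[OF al(3)] by simp
  finally have "m > 0" using l zero_less_mult_pos by blast
  \<comment> \<open>Losing at most \<open>e\<close> from each set lowers the minimum by at most
    \<open>e\<close> and raises the other side by at most \<open>2 * \<tau> * e\<close>. This choice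
    makes the total exactly the slack \<open>m\<close>.\<close>
  define e where "e = m / (1 + 2 * \<tau>)"
  have "e > 0" "e * (1 + 2 * \<tau>) = m" unfolding e_def using \<open>m > 0\<close> pos by simp_all
  then have e: "e > 0" "e + 2 * \<tau> * e = m" by (simp_all add: algebra_simps)
  have fin: "emeasure (borel_leb d) (pull Bp) < \<infinity>" "emeasure (borel_leb d) (pull Bm) < \<infinity>"
    using fmeasurable_unit_cube_subset[OF pull_sets[OF Bp(1)] subu(1)]
      fmeasurable_unit_cube_subset[OF pull_sets[OF Bm(1)] subu(2)] by (auto simp: fmeasurable_def)
  obtain Kp where Kp: "compact Kp" "Kp \<subseteq> pull Bp" "Kp \<in> sets (borel_leb d)" "?\<mu> Kp > ?\<mu> (pull Bp) - e"
    using compact_inner_approximation[OF pull_sets[OF Bp(1)] fin(1) e(1)] .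
  obtain Km where Km: "compact Km" "Km \<subseteq> pull Bm" "Km \<in> sets (borel_leb d)" "?\<mu> Km > ?\<mu> (pull Bm) - e"
    using compact_inner_approximation[OF pull_sets[OF Bm(1)] fin(2) e(1)] .
  have "Kp \<inter> Km = {}"
    using Kp(2) Km(2) Bp(2) Bm(2) disj unfolding pull_def by blast
  moreover have "\<tau> * (1 - ?\<mu> Kp - ?\<mu> Km) < min (?\<mu> Kp) (?\<mu> Km)"
  proof -
    have "\<tau> * (1 - ?\<mu> Kp - ?\<mu> Km) \<le> \<tau> * (1 - ?\<mu> (pull Bp) - ?\<mu> (pull Bm) + 2 * e)"
      using Kp(4) Km(4) pos by (intro mult_left_mono) auto
    also have "\<dots> = min (?\<mu> (pull Bp)) (?\<mu> (pull Bm)) - e"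
      using e(2) unfolding m_def by (simp add: algebra_simps)
    also have "\<dots> < min (?\<mu> Kp) (?\<mu> Km)" using Kp(4) Km(4) by (auto simp: min_def)
    finally show ?thesis .
  qed
  ultimately obtain W where W: "W \<in> cubes d" "W \<subseteq> unit_cube d"
    "s * ?\<mu> W \<le> min (?\<mu> (Kp \<inter> W)) (?\<mu> (Km \<inter> W))"
    using H[of Kp Km] Kp Km subu by blast
  \<comment> \<open>\<open>V\<close> is the image of \<open>W\<close> under \<open>T\<close>,
    written as a preimage under the inverse map so that it is visibly a cube.\<close>
  define V where "V = affine_map d (\<lambda>i. - (a i / l)) (1 / l) -` W \<inter> space (borel_leb d)"
  have V: "V \<in> cubes d"
    unfolding V_def using W(1) al(1) by (intro affine_map_vimage_cube) auto
  have pV: "pull V = W"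
    using al(1) sets.sets_into_space[OF cube_in_sets[OF W(1)]]
    unfolding pull_def V_def T_def by (auto simp: affine_map_inverse affine_map_in_space)
  have VQ: "V \<subseteq> Q"
  proof
    fix x assume x: "x \<in> V"
    then have u: "affine_map d (\<lambda>i. - (a i / l)) (1 / l) x \<in> unit_cube d" using W(2) unfolding V_def by auto
    show "x \<in> Q"
      unfolding al(2)
    proof (rule PiE_I)
      fix i assume "i \<in> {..<d}"
      then have "- (a i / l) + 1 / l * x i \<in> {0..1}"
        using u by (auto simp: affine_map_def unit_cube_def PiE_iff)
      then show "x i \<in> {a i .. a i + l}" using al(1) by (auto simp: field_simps)
    qed (use x in \<open>auto simp: V_def space_borel_leb PiE_iff extensional_def\<close>)
  qed
  \<comment> \<open>Common to both signs: the density of \<open>K\<close> in \<open>W\<close> bounds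
    that of \<open>pull B\<close> in \<open>W\<close>, which is the density of \<open>B\<close> in
    \<open>V\<close> since all measures scale by \<open>l ^ d\<close>; then \<open>B\<close> lies in
    \<open>E\<close>.\<close>
  have main: "s * measure (leb d) V \<le> measure (leb d) (E \<inter> V)"
    if K: "K \<subseteq> pull B" "K \<in> sets (borel_leb d)" "s * ?\<mu> W \<le> ?\<mu> (K \<inter> W)"
      and B: "B \<in> sets (borel_leb d)" "B \<subseteq> E" and E: "E \<in> sets (leb d)" for K B E
  proof -
    have Vs: "V \<in> sets (borel_leb d)" using V by (rule cube_in_sets)
    have "s * measure (leb d) V = l ^ d * (s * ?\<mu> W)"
      using pull_measure[OF Vs] measure_leb[OF Vs] pV by simp
    also have "\<dots> \<le> l ^ d * ?\<mu> (K \<inter> W)" using K(3) l by (intro mult_left_mono) auto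
    also have "\<dots> \<le> l ^ d * ?\<mu> (pull B \<inter> W)"
    proof (intro mult_left_mono measure_mono_fmeasurable)
      show "pull B \<inter> W \<in> fmeasurable (borel_leb d)"
        using W pull_sets[OF B(1)] cube_in_sets[OF W(1)] by (intro fmeasurable_unit_cube_subset) auto
    qed (use K l cube_in_sets[OF W(1)] in auto)
    also have "pull B \<inter> W = pull (B \<inter> V)" using pV unfolding pull_def by auto
    also have "l ^ d * ?\<mu> (pull (B \<inter> V)) = measure (leb d) (B \<inter> V)"
      using pull_measure[of "B \<inter> V"] B(1) Vs by (simp add: measure_leb)
    also have "\<dots> \<le> measure (leb d) (E \<inter> V)"
    proof (rule measure_mono_fmeasurable)
      show "E \<inter> V \<in> fmeasurable (leb d)"
        by (rule fmeasurableI2[OF cube_fmeasurable_leb[OF V]]) (use E Vs sets_leb in auto)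
      show "B \<inter> V \<in> sets (leb d)" using B(1) Vs sets_leb by auto
    qed (use B in auto)
    finally show ?thesis .
  qed
  have "s * measure (leb d) V \<le> min (measure (leb d) (Ep \<inter> V)) (measure (leb d) (Em \<inter> V))"
    using main[OF Kp(2,3) _ Bp(1,2) E(1)] main[OF Km(2,3) _ Bm(1,2) E(2)] W(3) by auto
  with V VQ show "\<exists>W\<in>cubes d. W \<subseteq> Q \<and>
      min (measure (leb d) (Ep \<inter> W)) (measure (leb d) (Em \<inter> W)) \<ge> s * measure (leb d) W"
    by blast
qed

subsection \<open>Approximation by multi-cubes\<close>

text \<open>The dyadic subcubes of a single generation \<open>n\<close>. The index functions are
  extensional, so that there are finitely many of them.\<close>

definition dyadic_grid :: "nat \<Rightarrow> nat \<Rightarrow> (nat \<Rightarrow> real) set set" where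
  "dyadic_grid d n =
     (\<lambda>c. PiE {..<d} (\<lambda>j. {(real_of_int (c j) - 1) / 2 ^ n .. real_of_int (c j) / 2 ^ n})) `
       (PiE {..<d} (\<lambda>_. {1..2 ^ n}))"

lemma finite_dyadic_grid: "finite (dyadic_grid d n)"
  unfolding dyadic_grid_def by (intro finite_imageI finite_PiE) auto

lemma dyadic_grid_subset: "n \<ge> 1 \<Longrightarrow> dyadic_grid d n \<subseteq> dyadic_subcubes d"
  unfolding dyadic_grid_def dyadic_subcubes_def by (auto simp: PiE_iff) blast

lemma dyadic_grid_diameter:
  assumes "D \<in> dyadic_grid d n" "x \<in> D" "y \<in> D" "i < d"
  shows "\<bar>x i - y i\<bar> \<le> 1 / 2 ^ n"
proof -
  from assms(1) obtain c :: "nat \<Rightarrow> int" where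
    D: "D = PiE {..<d} (\<lambda>j. {(real_of_int (c j) - 1) / 2 ^ n .. real_of_int (c j) / 2 ^ n})"
    unfolding dyadic_grid_def by auto
  have "x i \<in> {(real_of_int (c i) - 1) / 2 ^ n .. real_of_int (c i) / 2 ^ n}"
    "y i \<in> {(real_of_int (c i) - 1) / 2 ^ n .. real_of_int (c i) / 2 ^ n}"
    using assms(2-4) unfolding D by (meson PiE_mem lessThan_iff)+
  then show ?thesis by (auto simp: diff_divide_distrib)
qed

lemma dyadic_grid_in_unit_cube:
  assumes "D \<in> dyadic_grid d n" shows "D \<subseteq> unit_cube d"
proof -
  from assms obtain c :: "nat \<Rightarrow> int" where "c \<in> PiE {..<d} (\<lambda>_. {1..2 ^ n})"
    and D: "D = PiE {..<d} (\<lambda>j. {(real_of_int (c j) - 1) / 2 ^ n .. real_of_int (c j) / 2 ^ n})"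
    unfolding dyadic_grid_def by auto
  then have c: "1 \<le> c j \<and> c j \<le> 2 ^ n" if "j < d" for j
    using that by (auto simp: PiE_iff)
  show ?thesis
    unfolding D unit_cube_def
  proof (rule PiE_mono)
    fix j assume "j \<in> {..<d}"
    then have "real_of_int 1 \<le> real_of_int (c j)" "real_of_int (c j) \<le> real_of_int (2 ^ n)"
      using c[of j] by (simp_all only: of_int_le_iff lessThan_iff)
    then have "0 \<le> (real_of_int (c j) - 1) / 2 ^ n" "real_of_int (c j) / 2 ^ n \<le> 1" by auto
    then show "{(real_of_int (c j) - 1) / 2 ^ n .. real_of_int (c j) / 2 ^ n} \<subseteq> {0..1}" by auto
  qed
qed

lemma dyadic_grid_cover:
  assumes "x \<in> unit_cube d"
  obtains D where "D \<in> dyadic_grid d n" "x \<in> D"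
proof -
  \<comment> \<open>The maximum with 1 matters only if \<open>x j = 0\<close>, where the ceiling 0
    falls outside the index range.\<close>
  define c where "c = (\<lambda>j\<in>{..<d}. max 1 \<lceil>2 ^ n * x j\<rceil>)"
  have x: "0 \<le> x j" "x j \<le> 1" if "j < d" for j
    using assms that by (auto simp: unit_cube_def PiE_iff)
  have "c \<in> PiE {..<d} (\<lambda>_. {1..2 ^ n})"
  proof (rule PiE_I)
    fix j assume "j \<in> {..<d}"
    then have "2 ^ n * x j \<le> 2 ^ n" using x(2)[of j] by simp
    then have "\<lceil>2 ^ n * x j\<rceil> \<le> 2 ^ n" by (simp add: ceiling_le_iff)
    then show "c j \<in> {1..2 ^ n}" using \<open>j \<in> {..<d}\<close> by (simp add: c_def)
  qed (simp add: c_def)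
  moreover have "x \<in> PiE {..<d} (\<lambda>j. {(real_of_int (c j) - 1) / 2 ^ n .. real_of_int (c j) / 2 ^ n})"
  proof (rule PiE_I)
    fix j assume j: "j \<in> {..<d}"
    have "real_of_int \<lceil>2 ^ n * x j\<rceil> - 1 \<le> 2 ^ n * x j" "2 ^ n * x j \<le> real_of_int \<lceil>2 ^ n * x j\<rceil>"
      by linarith+
    moreover have "0 \<le> 2 ^ n * x j" using x(1)[of j] j by simp
    ultimately have "real_of_int (c j) - 1 \<le> 2 ^ n * x j" "2 ^ n * x j \<le> real_of_int (c j)"
      using j by (auto simp: c_def max_def)
    then show "x j \<in> {(real_of_int (c j) - 1) / 2 ^ n .. real_of_int (c j) / 2 ^ n}"
      by (simp add: field_simps)
  qed (use assms in \<open>auto simp: unit_cube_def PiE_iff extensional_def\<close>)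
  ultimately show ?thesis using that unfolding dyadic_grid_def by blast
qed

text \<open>\<open>E\<close> is the union of the cubes of generation \<open>n\<close> that meet
  \<open>K\<close>; each has side \<open>1 / 2 ^ n\<close>.\<close>

lemma dyadic_hull:
  assumes "K \<subseteq> unit_cube d" "K \<noteq> {}" "n \<ge> 1"
  obtains E where "multi_cube d E" "K \<subseteq> E"
    "\<And>x. x \<in> E \<Longrightarrow> \<exists>y\<in>K. \<forall>i<d. \<bar>x i - y i\<bar> \<le> 1 / 2 ^ n"
proof -
  define C where "C = {D \<in> dyadic_grid d n. D \<inter> K \<noteq> {}}"
  have KC: "K \<subseteq> \<Union>C"
  proof
    fix x assume "x \<in> K"
    with assms(1) obtain D where "D \<in> dyadic_grid d n" "x \<in> D"
      using dyadic_grid_cover by blast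
    with \<open>x \<in> K\<close> show "x \<in> \<Union>C" unfolding C_def by blast
  qed
  show ?thesis
  proof (rule that)
    show "multi_cube d (\<Union>C)"
      unfolding multi_cube_def
    proof (intro conjI exI[of _ C])
      show "\<Union>C \<noteq> {}" using KC assms(2) by blast
      show "\<Union>C \<subseteq> unit_cube d" using dyadic_grid_in_unit_cube unfolding C_def by blast
      show "finite C" using finite_dyadic_grid[of d n] unfolding C_def by auto
      show "C \<subseteq> dyadic_subcubes d" using dyadic_grid_subset[OF assms(3)] unfolding C_def by blast
    qed simp
    show "K \<subseteq> \<Union>C" by (rule KC)
    fix x assume "x \<in> \<Union>C"
    then obtain D y where "D \<in> dyadic_grid d n" "x \<in> D" "y \<in> D" "y \<in> K" unfolding C_def by blast
    then show "\<exists>y\<in>K. \<forall>i<d. \<bar>x i - y i\<bar> \<le> 1 / 2 ^ n"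
      using dyadic_grid_diameter by blast
  qed
qed

lemma dyadic_subcube_in_cubes:
  assumes "D \<in> dyadic_subcubes d" shows "D \<in> cubes d"
proof -
  from assms obtain n :: "nat \<Rightarrow> int" and k :: nat where
    "D = PiE {..<d} (\<lambda>j. {(real_of_int (n j) - 1) / 2 ^ k .. real_of_int (n j) / 2 ^ k})"
    unfolding dyadic_subcubes_def by blast
  then have "D = PiE {..<d} (\<lambda>j. {(real_of_int (n j) - 1) / 2 ^ k .. (real_of_int (n j) - 1) / 2 ^ k + 1 / 2 ^ k})"
    by (simp add: diff_divide_distrib)
  then show ?thesis
    unfolding cubes_def
    by (intro CollectI exI[of _ "\<lambda>j. (real_of_int (n j) - 1) / 2 ^ k"] exI[of _ "1 / 2 ^ k"]) auto
qed

lemma multi_cube_in_sets: "multi_cube d E \<Longrightarrow> E \<in> sets (borel_leb d)"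
  unfolding multi_cube_def
  by (metis cube_in_sets dyadic_subcube_in_cubes sets.finite_Union subset_iff)

lemma disjoint_measure_le_1:
  assumes "A \<in> sets (borel_leb d)" "B \<in> sets (borel_leb d)"
    and "A \<subseteq> unit_cube d" "B \<subseteq> unit_cube d" "A \<inter> B = {}"
  shows "measure (borel_leb d) A + measure (borel_leb d) B \<le> 1"
proof -
  have "A \<in> fmeasurable (borel_leb d)" "B \<in> fmeasurable (borel_leb d)"
    using assms fmeasurable_unit_cube_subset by blast+
  then have "measure (borel_leb d) A + measure (borel_leb d) B = measure (borel_leb d) (A \<union> B)"
    using assms(5) by (simp add: measure_Un3)
  also have "\<dots> \<le> measure (borel_leb d) (unit_cube d)"
    by (rule measure_mono_fmeasurable[OF _ _ cube_fmeasurable[OF unit_cube_in_cubes]]) (use assms in auto)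
  finally show ?thesis by (simp only: measure_unit_cube)
qed

text \<open>Two compact sets are replaced by dyadic hulls so close to them that the added measure is
  at most half of what density \<open>s\<close> amounts to in any cube meeting both hulls. This is
  where half of \<open>s\<close> is lost.\<close>

lemma John_Stromberg_pair_of_multi_cubes:
  assumes s: "s > 0" and
    H: "\<And>Ep Em. multi_cube d Ep \<Longrightarrow> multi_cube d Em \<Longrightarrow> Ep \<inter> Em = {} \<Longrightarrow>
      min (measure (leb d) Ep) (measure (leb d) Em) > \<tau> * (1 - measure (leb d) Ep - measure (leb d) Em) \<Longrightarrow>
      \<exists>W\<in>cubes d. W \<subseteq> unit_cube d \<and>
        min (measure (leb d) (W \<inter> Ep)) (measure (leb d) (W \<inter> Em)) \<ge> s * measure (leb d) W"
    and "\<tau> > 0"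
  shows "John_Stromberg_pair d \<tau> (s / 2)"
proof (rule John_Stromberg_pairI_compact)
  let ?\<mu> = "measure (borel_leb d)"
  fix Kp Km :: "(nat \<Rightarrow> real) set"
  assume K: "compact Kp" "compact Km" and sub: "Kp \<subseteq> unit_cube d" "Km \<subseteq> unit_cube d"
    and disj: "Kp \<inter> Km = {}"
    and big: "\<tau> * (1 - ?\<mu> Kp - ?\<mu> Km) < min (?\<mu> Kp) (?\<mu> Km)"
  have Ks: "Kp \<in> sets (borel_leb d)" "Km \<in> sets (borel_leb d)"
    using K sub by (auto intro: compact_in_borel_leb)
  have le1: "?\<mu> Kp + ?\<mu> Km \<le> 1"
    using disjoint_measure_le_1 Ks sub disj .
  \<comment> \<open>Nonnegativity of this side makes both measures in the strict inequality
    positive, so both sets are nonempty and have dyadic hulls.\<close>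
  have "0 \<le> \<tau> * (1 - ?\<mu> Kp - ?\<mu> Km)" using le1 \<open>\<tau> > 0\<close> by simp
  with big have "?\<mu> Kp > 0" "?\<mu> Km > 0" by auto
  then have ne: "Kp \<noteq> {}" "Km \<noteq> {}" by auto
  obtain \<delta> where \<delta>: "\<delta> > 0" "\<And>x y. x \<in> Kp \<Longrightarrow> y \<in> Km \<Longrightarrow> \<exists>i<d. \<delta> \<le> \<bar>x i - y i\<bar>"
    using compact_separation[OF K disj] sub unit_cube_subset_space[of d] by blast
  \<comment> \<open>A cube meeting both hulls will have side at least \<open>\<delta> / 2\<close>,
    so \<open>e\<close> is at most \<open>s / 2\<close> times its volume.\<close>
  define e where "e = s / 2 * (\<delta> / 2) ^ d"
  have "e > 0" using s \<delta>(1) by (simp add: e_def)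
  obtain \<eta>p where \<eta>p: "\<eta>p > 0" "\<And>\<epsilon>. \<epsilon> \<le> \<eta>p \<Longrightarrow> ?\<mu> (sup_nbhd d \<epsilon> Kp) < ?\<mu> Kp + e"
    using measure_sup_nbhd_small[OF K(1) sub(1) \<open>e > 0\<close>] by blast
  obtain \<eta>m where \<eta>m: "\<eta>m > 0" "\<And>\<epsilon>. \<epsilon> \<le> \<eta>m \<Longrightarrow> ?\<mu> (sup_nbhd d \<epsilon> Km) < ?\<mu> Km + e"
    using measure_sup_nbhd_small[OF K(2) sub(2) \<open>e > 0\<close>] by blast
  define \<epsilon> where "\<epsilon> = min (min \<eta>p \<eta>m) (\<delta> / 4)"
  have \<epsilon>: "\<epsilon> > 0" "\<epsilon> \<le> \<eta>p" "\<epsilon> \<le> \<eta>m" "\<epsilon> \<le> \<delta> / 4"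
    using \<eta>p(1) \<eta>m(1) \<delta>(1) by (auto simp: \<epsilon>_def)
  obtain n0 where n0: "(1 / 2) ^ n0 < \<epsilon>"
    using real_arch_pow_inv[OF \<epsilon>(1), of "1 / 2"] by auto
  define n where "n = Suc n0"
  have n: "n \<ge> 1" "1 / 2 ^ n < \<epsilon>"
  proof -
    have "(1 / 2 :: real) ^ n \<le> (1 / 2) ^ n0" unfolding n_def by (intro power_decreasing) auto
    with n0 show "1 / 2 ^ n < \<epsilon>" by (simp add: power_divide)
  qed (simp add: n_def)
  obtain Ep where Ep: "multi_cube d Ep" "Kp \<subseteq> Ep"
    "\<And>x. x \<in> Ep \<Longrightarrow> \<exists>y\<in>Kp. \<forall>i<d. \<bar>x i - y i\<bar> \<le> 1 / 2 ^ n"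
    using dyadic_hull[OF sub(1) ne(1) n(1)] by metis
  obtain Em where Em: "multi_cube d Em" "Km \<subseteq> Em"
    "\<And>x. x \<in> Em \<Longrightarrow> \<exists>y\<in>Km. \<forall>i<d. \<bar>x i - y i\<bar> \<le> 1 / 2 ^ n"
    using dyadic_hull[OF sub(2) ne(2) n(1)] by metis
  have Es: "Ep \<in> sets (borel_leb d)" "Em \<in> sets (borel_leb d)"
    using Ep(1) Em(1) multi_cube_in_sets by auto
  have Eu: "Ep \<subseteq> unit_cube d" "Em \<subseteq> unit_cube d"
    using Ep(1) Em(1) unfolding multi_cube_def by auto
  \<comment> \<open>Passing to the hulls moves each point by less than \<open>\<delta> / 4\<close>,
    so at least half of the separation survives.\<close>
  have far: "\<exists>i<d. \<delta> / 2 < \<bar>x i - y i\<bar>" if x: "x \<in> Ep" and y: "y \<in> Em" for x y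
  proof -
    obtain x' y' where xy: "x' \<in> Kp" "\<forall>i<d. \<bar>x i - x' i\<bar> \<le> 1 / 2 ^ n"
        "y' \<in> Km" "\<forall>i<d. \<bar>y i - y' i\<bar> \<le> 1 / 2 ^ n"
      using Ep(3)[OF x] Em(3)[OF y] by blast
    then obtain i where i: "i < d" "\<delta> \<le> \<bar>x' i - y' i\<bar>" using \<delta>(2) by blast
    moreover have "\<bar>x i - x' i\<bar> < \<delta> / 4" "\<bar>y i - y' i\<bar> < \<delta> / 4"
      using xy i(1) n(2) \<epsilon>(4) by fastforce+
    ultimately show ?thesis by (intro exI[of _ i]) linarith
  qed
  have "Ep \<inter> Em = {}"
    using far \<delta>(1) by fastforce
  have fin: "A \<in> fmeasurable (borel_leb d)" if "A \<in> sets (borel_leb d)" "A \<subseteq> unit_cube d" for A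
    using fmeasurable_unit_cube_subset that by blast
  have ge: "?\<mu> Kp \<le> ?\<mu> Ep" "?\<mu> Km \<le> ?\<mu> Em"
    using Ep(2) Em(2) Ks Es Eu by (auto intro!: measure_mono_fmeasurable fin)
  have "min (measure (leb d) Ep) (measure (leb d) Em) > \<tau> * (1 - measure (leb d) Ep - measure (leb d) Em)"
  proof -
    have "\<tau> * (1 - ?\<mu> Ep - ?\<mu> Em) \<le> \<tau> * (1 - ?\<mu> Kp - ?\<mu> Km)"
      using ge \<open>\<tau> > 0\<close> by (intro mult_left_mono) auto
    then show ?thesis using big ge by (simp add: measure_leb Es)
  qed
  from H[OF Ep(1) Em(1) \<open>Ep \<inter> Em = {}\<close> this] obtain W where W: "W \<in> cubes d" "W \<subseteq> unit_cube d"
    "min (measure (leb d) (W \<inter> Ep)) (measure (leb d) (W \<inter> Em)) \<ge> s * measure (leb d) W"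
    by blast
  from W(1) obtain a l where al: "l > 0" "W = PiE {..<d} (\<lambda>j. {a j .. a j + l})"
    "W \<in> sets (borel_leb d)" "?\<mu> W = l ^ d"
    by (rule cubesE)
  have Wmin: "s * l ^ d \<le> ?\<mu> (W \<inter> Ep)" "s * l ^ d \<le> ?\<mu> (W \<inter> Em)"
    using W(3) al Es by (auto simp: measure_leb)
  moreover have "s * l ^ d > 0" using s al(1) by simp
  ultimately have "?\<mu> (W \<inter> Ep) > 0" "?\<mu> (W \<inter> Em) > 0" by linarith+
  then have "W \<inter> Ep \<noteq> {}" "W \<inter> Em \<noteq> {}" by auto
  then obtain x y where xy: "x \<in> W" "x \<in> Ep" "y \<in> W" "y \<in> Em" by blast
  then obtain i where i: "i < d" "\<delta> / 2 < \<bar>x i - y i\<bar>" using far by blast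
  have "x i \<in> {a i .. a i + l}" "y i \<in> {a i .. a i + l}" using xy(1,3) i(1) unfolding al(2) by (meson PiE_mem lessThan_iff)+
  with i(2) have "\<delta> / 2 \<le> l" unfolding atLeastAtMost_iff by linarith
  then have "e \<le> s / 2 * l ^ d"
    unfolding e_def using s \<delta>(1) by (intro mult_left_mono power_mono) auto
  \<comment> \<open>The part of \<open>E\<close> outside \<open>K\<close> has measure below
    \<open>e\<close>, so \<open>K\<close> retains at least half of the density of \<open>E\<close>
    in \<open>W\<close>.\<close>
  have main: "s / 2 * ?\<mu> W \<le> ?\<mu> (K \<inter> W)"
    if "K \<in> sets (borel_leb d)" "K \<subseteq> E" "E \<in> sets (borel_leb d)" "E \<subseteq> unit_cube d"
       "E \<subseteq> sup_nbhd d \<epsilon> K" "?\<mu> (sup_nbhd d \<epsilon> K) < ?\<mu> K + e" "s * l ^ d \<le> ?\<mu> (W \<inter> E)" for K E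
  proof -
    have "?\<mu> (W \<inter> E) \<le> ?\<mu> ((K \<inter> W) \<union> (E - K))"
      using that al(3) by (intro measure_mono_fmeasurable fin) auto
    also have "\<dots> \<le> ?\<mu> (K \<inter> W) + ?\<mu> (E - K)"
      using that al(3) by (intro measure_Un_le) auto
    also have "?\<mu> (E - K) = ?\<mu> E - ?\<mu> K"
      using that by (intro measurable_measure_Diff fin) auto
    also have "?\<mu> E \<le> ?\<mu> (sup_nbhd d \<epsilon> K)"
      using that by (intro measure_mono_fmeasurable fin sup_nbhd_in_sets) (auto simp: sup_nbhd_def)
    finally show ?thesis using that \<open>e \<le> s / 2 * l ^ d\<close> al(4) by simp
  qed
  have nb: "E \<subseteq> sup_nbhd d \<epsilon> K"
    if "\<And>x. x \<in> E \<Longrightarrow> \<exists>y\<in>K. \<forall>i<d. \<bar>x i - y i\<bar> \<le> 1 / 2 ^ n" "E \<subseteq> unit_cube d" for E K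
  proof
    fix x assume "x \<in> E"
    with that obtain y where "y \<in> K" "\<forall>i<d. \<bar>x i - y i\<bar> \<le> 1 / 2 ^ n" by blast
    with n(2) have "\<forall>i<d. \<bar>x i - y i\<bar> < \<epsilon>" by force
    with \<open>x \<in> E\<close> \<open>y \<in> K\<close> that(2) show "x \<in> sup_nbhd d \<epsilon> K" unfolding sup_nbhd_def by blast
  qed
  have "s / 2 * ?\<mu> W \<le> min (?\<mu> (Kp \<inter> W)) (?\<mu> (Km \<inter> W))"
    using main[OF Ks(1) Ep(2) Es(1) Eu(1) nb[OF Ep(3) Eu(1)] \<eta>p(2)[OF \<epsilon>(2)] Wmin(1)]
      main[OF Ks(2) Em(2) Es(2) Eu(2) nb[OF Em(3) Eu(2)] \<eta>m(2)[OF \<epsilon>(3)] Wmin(2)] by simp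
  with W show "\<exists>W\<in>cubes d. W \<subseteq> unit_cube d \<and> s / 2 * ?\<mu> W \<le> min (?\<mu> (Kp \<inter> W)) (?\<mu> (Km \<inter> W))"
    by blast
qed (use assms in auto)

subsection \<open>Stripes and cylinders\<close>

text \<open>Periodic stripes with period \<open>1 / N\<close>, density \<open>\<theta>\<close> and
  phase \<open>c\<close>. Phases 0 and 1/2 will serve the two signs.\<close>

definition stripes :: "nat \<Rightarrow> real \<Rightarrow> real \<Rightarrow> real set" where
  "stripes N \<theta> c = (\<Union>k<N. {(real k + c) / N .. (real k + c + \<theta>) / N})"

lemma stripes_borel: "stripes N \<theta> c \<in> sets borel"
  unfolding stripes_def by auto

text \<open>For \<open>\<theta> \<le> 1\<close> the sum is the total length below \<open>x\<close>
  of the intervals from \<open>k\<close> to \<open>k + \<theta>\<close> with \<open>k < N\<close>.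
  Each interval stands at the start of its period, so this length never lags behind the average
  growth \<open>\<theta> * x\<close>.\<close>

lemma sum_truncations_lower:
  fixes x \<theta> :: real
  assumes "0 \<le> \<theta>" "\<theta> \<le> 1" "x \<le> real N"
  shows "\<theta> * x \<le> (\<Sum>k<N. max 0 (min (x - real k) \<theta>))"
  using assms(3)
proof (induction N)
  case 0
  then show ?case using assms(1) by (simp add: mult_nonneg_nonpos)
next
  case (Suc N)
  show ?case
  proof (cases "x \<le> real N")
    case True
    with Suc.IH show ?thesis by simp
  next
    case False
    have "(\<Sum>k<N. max 0 (min (x - real k) \<theta>)) = (\<Sum>k<N. \<theta>)"
      using False assms(1,2) by (intro sum.cong) auto
    moreover have "\<theta> * (x - real N) \<le> x - real N"
      using False assms(1,2) by (intro mult_left_le_one_le) auto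
    moreover have "\<theta> * (x - real N) \<le> \<theta>"
      using assms(1) Suc.prems by (intro mult_left_le) auto
    moreover have "\<theta> * x = \<theta> * real N + \<theta> * (x - real N)" by (simp add: algebra_simps)
    ultimately show ?thesis by (simp add: mult.commute)
  qed
qed

text \<open>The same length exceeds the average growth by at most one interval: the terms with
  \<open>k \<ge> x\<close> vanish and every other one is at most \<open>\<theta>\<close>.\<close>

lemma sum_truncations_upper:
  fixes x \<theta> :: real
  assumes "0 \<le> \<theta>" "- 1 \<le> x"
  shows "(\<Sum>k<N. max 0 (min (x - real k) \<theta>)) \<le> \<theta> * x + \<theta>"
proof (induction N)
  case 0
  have "0 \<le> \<theta> * (x + 1)" using assms by (intro mult_nonneg_nonneg) auto
  then show ?case by (simp add: algebra_simps)
next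
  case (Suc N)
  show ?case
  proof (cases "x \<le> real N")
    case True
    with Suc.IH show ?thesis by simp
  next
    case False
    have "(\<Sum>k<Suc N. max 0 (min (x - real k) \<theta>)) \<le> (\<Sum>k<Suc N. \<theta>)"
      using assms(1) by (intro sum_mono) auto
    also have "\<dots> = \<theta> * (real N + 1)" by (simp add: algebra_simps)
    also have "\<dots> \<le> \<theta> * (x + 1)" using False assms(1) by (intro mult_left_mono) auto
    finally show ?thesis by (simp add: algebra_simps)
  qed
qed

text \<open>After rescaling, the length is bounded by the difference of the sums of truncations at
  the two endpoints. The upper bound at \<open>b\<close> and the lower bound at \<open>a\<close>
  differ from the exact average by one stripe, which is the error
  \<open>\<theta> / N\<close>.\<close>

lemma measure_stripes_Int_interval_le:
  assumes N: "N > 0" and \<theta>: "0 \<le> \<theta>" "\<theta> \<le> 1" and c: "0 \<le> c" "c \<le> 1"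
    and ab: "0 \<le> a" "a \<le> b" "b \<le> 1"
  shows "measure lborel ({a..b} \<inter> stripes N \<theta> c) \<le> \<theta> * (b - a) + \<theta> / N"
proof -
  let ?J = "\<lambda>k. {(real k + c) / N .. (real k + c + \<theta>) / N}"
  let ?h = "\<lambda>t k. max 0 (min (t - real k) \<theta>)"
  have J: "measure lborel ({a..b} \<inter> ?J k) = (?h (N * b - c) k - ?h (N * a - c) k) / N" for k
  proof -
    \<comment> \<open>In units of \<open>1 / N\<close>, measured from the left end of stripe
      \<open>k\<close>, the interval runs from \<open>w\<close> to \<open>z\<close> and the stripe
      from 0 to \<open>\<theta>\<close>.\<close>
    define w z where "w = N * a - c - real k" and "z = N * b - c - real k"
    have "w \<le> z" unfolding w_def z_def using N ab(2) by simp
    have a: "a = (real k + c) / N + w / N" and b: "b = (real k + c) / N + z / N"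
      using N by (auto simp: w_def z_def field_simps)
    have "{a..b} \<inter> ?J k = {(real k + c) / N + max w 0 / N .. (real k + c) / N + min z \<theta> / N}"
      using N unfolding a b by (auto simp: max_def min_def add_divide_distrib divide_right_mono)
         (auto simp: field_simps)
    moreover have "measure lborel {p..q} = max 0 (q - p)" for p q :: real
      by (cases "p \<le> q") auto
    ultimately have "measure lborel ({a..b} \<inter> ?J k) = max 0 (min z \<theta> / N - max w 0 / N)"
      by (simp only: add_diff_cancel_left)
    also have "\<dots> = max 0 (min z \<theta> - max w 0) / N"
      by (simp add: max_divide_distrib_right diff_divide_distrib)
    also have "max 0 (min z \<theta> - max w 0) = max 0 (min z \<theta>) - max 0 (min w \<theta>)"
      using \<open>w \<le> z\<close> \<theta> by (auto simp: max_def min_def)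
    finally show ?thesis by (simp add: w_def z_def)
  qed
  have "{a..b} \<inter> stripes N \<theta> c = (\<Union>k<N. {a..b} \<inter> ?J k)"
    unfolding stripes_def by auto
  then have "measure lborel ({a..b} \<inter> stripes N \<theta> c) \<le> (\<Sum>k<N. measure lborel ({a..b} \<inter> ?J k))"
    by (simp only:) (rule measure_UNION_le, auto)
  also have "\<dots> = ((\<Sum>k<N. ?h (N * b - c) k) - (\<Sum>k<N. ?h (N * a - c) k)) / N"
    unfolding J by (simp only: sum_subtractf sum_divide_distrib[symmetric])
  also have "\<dots> \<le> ((\<theta> * (N * b - c) + \<theta>) - \<theta> * (N * a - c)) / N"
  proof (intro divide_right_mono diff_mono sum_truncations_lower sum_truncations_upper \<theta>)
    have "0 \<le> N * b" using ab by simp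
    then show "- 1 \<le> N * b - c" using c by linarith
    have "N * a \<le> N" using ab by (simp add: mult_left_le)
    then show "N * a - c \<le> real N" using c by linarith
  qed simp
  also have "\<dots> = \<theta> * (b - a) + \<theta> / N"
    using N by (simp add: field_simps)
  finally show ?thesis .
qed

text \<open>For \<open>\<theta> < 1\<close> the \<open>N\<close> stripes are disjoint, each of
  length \<open>\<theta> / N\<close>.\<close>

lemma emeasure_stripes:
  assumes N: "N > 0" and \<theta>: "0 \<le> \<theta>" "\<theta> < 1"
  shows "emeasure lborel (stripes N \<theta> c) = ennreal \<theta>"
proof -
  let ?J = "\<lambda>k. {(real k + c) / N .. (real k + c + \<theta>) / N}"
  have "disjoint_family_on ?J {..<N}"
    unfolding disjoint_family_on_def
  proof (intro ballI impI)
    have *: "?J m \<inter> ?J n = {}" if "m < n" for m n :: nat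
    proof -
      have "real m + 1 \<le> real n" using that by linarith
      then have "(real m + c + \<theta>) / N < (real n + c) / N"
        using N \<theta> by (intro divide_strict_right_mono) auto
      then show ?thesis by auto
    qed
    fix m n :: nat assume "m \<noteq> n"
    then show "?J m \<inter> ?J n = {}" using *[of m n] *[of n m] by (cases "m < n") auto
  qed
  then have "emeasure lborel (stripes N \<theta> c) = (\<Sum>k<N. emeasure lborel (?J k))"
    unfolding stripes_def by (intro sum_emeasure[symmetric]) auto
  also have "\<dots> = (\<Sum>k<N. ennreal (\<theta> / N))"
    using N \<theta> by (intro sum.cong) (auto simp: divide_right_mono diff_divide_distrib[symmetric])
  also have "\<dots> = ennreal \<theta>"
    using N \<theta> by (subst sum_ennreal) auto
  finally show ?thesis .
qed

text \<open>Scaled by \<open>N\<close>, the stripes start at integers and at half-integers and have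
  length \<open>\<theta>\<close>; whichever comes first, \<open>1 / 2 - \<theta>\<close> remains
  between them.\<close>

lemma stripes_gap:
  assumes N: "N > 0" and "t \<in> stripes N \<theta> 0" "u \<in> stripes N \<theta> (1 / 2)"
  shows "(1 / 2 - \<theta>) / N \<le> \<bar>t - u\<bar>"
proof -
  from assms obtain k j where
    "real k / N \<le> t" "t \<le> (real k + \<theta>) / N" "(real j + 1 / 2) / N \<le> u" "u \<le> (real j + 1 / 2 + \<theta>) / N"
    unfolding stripes_def by auto
  then have *: "real k \<le> N * t" "N * t \<le> real k + \<theta>" "real j + 1 / 2 \<le> N * u" "N * u \<le> real j + 1 / 2 + \<theta>"
    using N by (auto simp: field_simps)
  have "1 / 2 - \<theta> \<le> \<bar>N * t - N * u\<bar>"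
  proof (cases "k \<le> j")
    case True
    then have "real k \<le> real j" by simp
    with * show ?thesis by linarith
  next
    case False
    then have "real j + 1 \<le> real k" by linarith
    with * show ?thesis by linarith
  qed
  also have "\<dots> = N * \<bar>t - u\<bar>" by (simp add: abs_mult flip: right_diff_distrib)
  finally show ?thesis using N by (simp add: field_simps)
qed

lemma stripes_subset_unit:
  assumes N: "N > 0" and "0 \<le> c" "c + \<theta> \<le> 1"
  shows "stripes N \<theta> c \<subseteq> {0..1}"
proof
  fix t assume "t \<in> stripes N \<theta> c"
  then obtain k where k: "k < N" "(real k + c) / N \<le> t" "t \<le> (real k + c + \<theta>) / N"
    unfolding stripes_def by auto
  have "0 \<le> (real k + c) / N" using assms by simp
  moreover have "real k + 1 \<le> N" using k(1) by linarith
  then have "(real k + c + \<theta>) / N \<le> 1" using assms by simp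
  with k(3) have "t \<le> 1" by (rule order_trans)
  ultimately show "t \<in> {0..1}" using k(2) by auto
qed

text \<open>The product of \<open>B\<close> and \<open>C\<close> inside the space of dimension
  \<open>d + 1\<close>, whose new coordinate has index \<open>d\<close>.\<close>

definition cylinder :: "nat \<Rightarrow> (nat \<Rightarrow> real) set \<Rightarrow> real set \<Rightarrow> (nat \<Rightarrow> real) set" where
  "cylinder d B C = {x \<in> space (borel_leb (Suc d)). restrict x {..<d} \<in> B \<and> x d \<in> C}"

lemma cylinder_in_sets:
  assumes [measurable]: "B \<in> sets (borel_leb d)" "C \<in> sets borel"
  shows "cylinder d B C \<in> sets (borel_leb (Suc d))"
proof -
  have [measurable]: "(\<lambda>x. restrict x {..<d}) \<in> measurable (borel_leb (Suc d)) (borel_leb d)"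
    by (rule measurable_restrict_subset) auto
  have [measurable]: "(\<lambda>x. x d) \<in> measurable (borel_leb (Suc d)) borel"
    using measurable_component_singleton[of d "{..<Suc d}" "\<lambda>_. lborel"] by simp
  show ?thesis unfolding cylinder_def by measurable
qed

text \<open>Tonelli's theorem, with the new coordinate integrated first.\<close>

lemma emeasure_cylinder:
  assumes BC: "B \<in> sets (borel_leb d)" "C \<in> sets borel"
  shows "emeasure (borel_leb (Suc d)) (cylinder d B C) = emeasure (borel_leb d) B * emeasure lborel C"
proof -
  have eq: "{..<Suc d} = insert d {..<d}" by auto
  have "emeasure (borel_leb (Suc d)) (cylinder d B C) = (\<integral>\<^sup>+x. indicator (cylinder d B C) x \<partial>borel_leb (Suc d))"
    using cylinder_in_sets[OF BC] by simp
  also have "\<dots> = (\<integral>\<^sup>+x. (\<integral>\<^sup>+y. indicator (cylinder d B C) (x(d := y)) \<partial>lborel) \<partial>borel_leb d)"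
    unfolding eq
    by (rule lborel_product.product_nn_integral_insert)
       (use cylinder_in_sets[OF BC] in \<open>auto simp flip: eq\<close>)
  also have "\<dots> = (\<integral>\<^sup>+x. indicator B x * emeasure lborel C \<partial>borel_leb d)"
  proof (rule nn_integral_cong)
    fix x assume x: "x \<in> space (borel_leb d)"
    then have "restrict (x(d := y)) {..<d} = x" for y
      by (intro extensionalityI[of _ "{..<d}"]) (auto simp: space_borel_leb PiE_def)
    moreover have "x(d := y) \<in> space (borel_leb (Suc d))" for y
      using x by (auto simp: space_borel_leb PiE_def extensional_def)
    ultimately have "indicator (cylinder d B C) (x(d := y)) = (indicator B x * indicator C y :: ennreal)" for y
      by (auto simp: cylinder_def indicator_def)
    then show "(\<integral>\<^sup>+y. indicator (cylinder d B C) (x(d := y)) \<partial>lborel) = indicator B x * emeasure lborel C"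
      using BC by (simp add: nn_integral_cmult)
  qed
  also have "\<dots> = emeasure (borel_leb d) B * emeasure lborel C"
    using BC by (simp add: nn_integral_multc)
  finally show ?thesis .
qed

lemma measure_cylinder:
  assumes "B \<in> sets (borel_leb d)" "C \<in> sets borel"
  shows "measure (borel_leb (Suc d)) (cylinder d B C) = measure (borel_leb d) B * measure lborel C"
  using emeasure_cylinder[OF assms] by (simp add: measure_def enn2real_mult)

lemma PiE_Suc_cylinder: "PiE {..<Suc d} A = cylinder d (PiE {..<d} A) (A d)"
proof (rule set_eqI)
  fix x
  have "x \<in> PiE {..<Suc d} A \<longleftrightarrow> x \<in> extensional {..<Suc d} \<and> (\<forall>i<d. x i \<in> A i) \<and> x d \<in> A d"
    unfolding PiE_iff Ball_def lessThan_iff less_Suc_eq by blast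
  also have "\<dots> \<longleftrightarrow> x \<in> cylinder d (PiE {..<d} A) (A d)"
    unfolding cylinder_def space_borel_leb PiE_iff by auto
  finally show "x \<in> PiE {..<Suc d} A \<longleftrightarrow> x \<in> cylinder d (PiE {..<d} A) (A d)" .
qed

text \<open>The lowest and the highest corner of \<open>W\<close> belong to the unit cube.\<close>

lemma subcubeE:
  assumes "W \<in> cubes d" "W \<subseteq> unit_cube d"
  obtains a l where "l > 0" "W = PiE {..<d} (\<lambda>j. {a j .. a j + l})"
    "\<And>j. j < d \<Longrightarrow> 0 \<le> a j \<and> a j + l \<le> 1"
proof -
  from assms(1) obtain a l where al: "l > 0" "W = PiE {..<d} (\<lambda>j. {a j .. a j + l})" by (rule cubesE)
  have "restrict a {..<d} \<in> W" "restrict (\<lambda>j. a j + l) {..<d} \<in> W"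
    using al by (auto simp: PiE_iff)
  then have *: "restrict a {..<d} \<in> unit_cube d" "restrict (\<lambda>j. a j + l) {..<d} \<in> unit_cube d"
    using assms(2) by auto
  have "0 \<le> a j \<and> a j + l \<le> 1" if "j < d" for j
    using * that unfolding unit_cube_def PiE_iff by auto
  with al that show ?thesis by blast
qed

subsection \<open>Improving the constant\<close>

lemma John_Stromberg_pair_mono:
  assumes "John_Stromberg_pair d \<sigma> s" "\<sigma> \<le> \<tau>"
  shows "John_Stromberg_pair d \<tau> s"
proof -
  have "\<sigma> * measure (leb d) A \<le> \<tau> * measure (leb d) A" for A
    using assms(2) by (rule mult_right_mono) simp
  then show ?thesis
    using assms unfolding John_Stromberg_pair_def by (meson le_less_trans less_le_trans)
qed

lemma unit_cube_Suc: "unit_cube (Suc d) = cylinder d (unit_cube d) {0..1}"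
  unfolding unit_cube_def by (rule PiE_Suc_cylinder)

lemma cylinder_mono: "B \<subseteq> B' \<Longrightarrow> C \<subseteq> C' \<Longrightarrow> cylinder d B C \<subseteq> cylinder d B' C'"
  unfolding cylinder_def by auto

text \<open>Two halves of the unit cube leave nothing uncovered, so the hypothesis of the pair holds
  for them. The resulting cube contains two disjoint parts of density at least \<open>s\<close>.
  Dimension \<open>Suc d\<close> guarantees a coordinate to halve.\<close>

lemma John_Stromberg_pair_density_le_half:
  assumes "John_Stromberg_pair (Suc d) \<tau> s"
  shows "s \<le> 1 / 2"
proof -
  define Ep where "Ep = cylinder d (unit_cube d) {0..1 / 2}"
  define Em where "Em = cylinder d (unit_cube d) {1 / 2<..1}"
  let ?\<mu> = "measure (leb (Suc d))"
  have sets: "Ep \<in> sets (borel_leb (Suc d))" "Em \<in> sets (borel_leb (Suc d))"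
    unfolding Ep_def Em_def by (simp_all add: cylinder_in_sets unit_cube_in_sets)
  have half: "?\<mu> Ep = 1 / 2" "?\<mu> Em = 1 / 2"
    unfolding measure_leb[OF sets(1)] measure_leb[OF sets(2)] unfolding Ep_def Em_def
    by (simp_all add: measure_cylinder unit_cube_in_sets measure_unit_cube)
  have Q: "unit_cube (Suc d) \<in> cubes (Suc d)" by (rule unit_cube_in_cubes)
  have sub: "Ep \<subseteq> unit_cube (Suc d)" "Em \<subseteq> unit_cube (Suc d)"
    unfolding Ep_def Em_def unit_cube_Suc by (intro cylinder_mono; auto)+
  have disj: "Ep \<inter> Em = {}" unfolding Ep_def Em_def cylinder_def by auto
  have "\<tau> * ?\<mu> (unit_cube (Suc d) - Ep - Em) < min (?\<mu> Ep) (?\<mu> Em)"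
    using leb_Diff_measure[OF Q sets_leb[OF sets(1)] sets_leb[OF sets(2)] sub disj] half
      measure_leb[OF unit_cube_in_sets[of "Suc d"]] by (simp add: measure_unit_cube)
  then obtain W where W: "W \<in> cubes (Suc d)" "min (?\<mu> (Ep \<inter> W)) (?\<mu> (Em \<inter> W)) \<ge> s * ?\<mu> W"
    using assms Q sets_leb[OF sets(1)] sets_leb[OF sets(2)] sub disj unfolding John_Stromberg_pair_def by metis
  have fin: "W \<in> fmeasurable (leb (Suc d))" using W(1) by (rule cube_fmeasurable_leb)
  then have fin': "Ep \<inter> W \<in> fmeasurable (leb (Suc d))" "Em \<inter> W \<in> fmeasurable (leb (Suc d))"
    using sets_leb[OF sets(1)] sets_leb[OF sets(2)] by (auto intro: fmeasurableI2)
  have "2 * (s * ?\<mu> W) \<le> ?\<mu> (Ep \<inter> W) + ?\<mu> (Em \<inter> W)" using W(2) by simp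
  also have "\<dots> = ?\<mu> ((Ep \<inter> W) \<union> (Em \<inter> W)) + ?\<mu> ((Ep \<inter> W) \<inter> (Em \<inter> W))"
    using measure_Un3[OF fin'] by simp
  also have "(Ep \<inter> W) \<inter> (Em \<inter> W) = {}" using disj by auto
  also have "?\<mu> ((Ep \<inter> W) \<union> (Em \<inter> W)) \<le> ?\<mu> W"
    using fin fin' by (intro measure_mono_fmeasurable) auto
  finally have "2 * s * ?\<mu> W \<le> 1 * ?\<mu> W" by simp
  then show ?thesis
    using measure_cube_pos[OF W(1)] by (simp only: mult_le_cancel_right_pos)
qed

text \<open>Let R be the measure left over by the two compact sets. Stripes of density
  \<open>s / 4\<close> over nearly all of it raise the minimum by about (s/4)R and lower the
  remainder by about (s/2)R. The condition with constant 1/2 upstairs thus becomes the condition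
  with \<open>(1 - s) / 2\<close> downstairs.\<close>

lemma John_Stromberg_pair_improve:
  assumes JS: "John_Stromberg_pair (Suc d) (1 / 2) s" and "s \<le> 1 / 2"
  shows "John_Stromberg_pair d ((1 - s) / 2) (s / 2)"
proof (rule John_Stromberg_pairI_compact)
  let ?\<mu> = "measure (borel_leb d)" and ?\<nu> = "measure (borel_leb (Suc d))"
  have s: "s > 0" using JS by (simp add: John_Stromberg_pair_def)
  then show "s / 2 > 0" by simp
  show "(1 - s) / 2 > 0" using \<open>s \<le> 1 / 2\<close> by simp
  fix Kp Km :: "(nat \<Rightarrow> real) set"
  assume K: "compact Kp" "compact Km" and sub: "Kp \<subseteq> unit_cube d" "Km \<subseteq> unit_cube d"
    and disj: "Kp \<inter> Km = {}"
    and big: "(1 - s) / 2 * (1 - ?\<mu> Kp - ?\<mu> Km) < min (?\<mu> Kp) (?\<mu> Km)"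
  have Ks: "Kp \<in> sets (borel_leb d)" "Km \<in> sets (borel_leb d)"
    using K sub by (auto intro: compact_in_borel_leb)
  have fin: "A \<in> fmeasurable (borel_leb d)" if "A \<in> sets (borel_leb d)" "A \<subseteq> unit_cube d" for A
    using fmeasurable_unit_cube_subset that by blast
  have fin': "A \<in> fmeasurable (borel_leb (Suc d))"
    if "A \<in> sets (borel_leb (Suc d))" "A \<subseteq> unit_cube (Suc d)" for A
    using fmeasurable_unit_cube_subset that by blast
  \<comment> \<open>The slack \<open>m\<close> pays for the part of the remainder near the compact
    sets that carries no stripes.\<close>
  define m where "m = min (?\<mu> Kp) (?\<mu> Km) - (1 - s) / 2 * (1 - ?\<mu> Kp - ?\<mu> Km)"
  have "m > 0" using big by (simp add: m_def)
  \<comment> \<open>With \<open>s = 4 * \<theta>\<close>, a long cube sees stripes of density at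
    most \<open>2 * \<theta>\<close>, leaving \<open>s / 2\<close>, and a short one meeting both
    families at most \<open>11 / 3 * \<theta>\<close>, which is less than \<open>s\<close>.\<close>
  define \<theta> where "\<theta> = s / 4"
  have \<theta>: "0 < \<theta>" "\<theta> \<le> 1 / 8" using s \<open>s \<le> 1 / 2\<close> by (auto simp: \<theta>_def)
  obtain \<delta>0 where \<delta>0: "\<delta>0 > 0" "\<And>x y. x \<in> Kp \<Longrightarrow> y \<in> Km \<Longrightarrow> \<exists>i<d. \<delta>0 \<le> \<bar>x i - y i\<bar>"
    using compact_separation[OF K disj] sub unit_cube_subset_space[of d] by blast
  obtain \<eta> where \<eta>: "\<eta> > 0"
    "\<And>\<delta>. \<delta> \<le> \<eta> \<Longrightarrow> ?\<mu> (sup_nbhd d \<delta> (Kp \<union> Km)) < ?\<mu> (Kp \<union> Km) + m"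
    using measure_sup_nbhd_small[of "Kp \<union> Km" d m] K sub \<open>m > 0\<close> by (metis Un_subset_iff compact_Un)
  \<comment> \<open>Small enough to separate the two compact sets and to leave \<open>G\<close>
    almost the full measure of the remainder.\<close>
  define \<delta> where "\<delta> = min \<delta>0 \<eta>"
  have \<delta>: "\<delta> > 0" "\<delta> \<le> \<delta>0" "\<delta> \<le> \<eta>" using \<delta>0(1) \<eta>(1) by (auto simp: \<delta>_def)
  obtain n where "1 / real (Suc n) < \<delta>" using nat_approx_posE[OF \<delta>(1)] by blast
  \<comment> \<open>The period is below \<open>\<delta>\<close>, so cubes of side at least
    \<open>\<delta>\<close> average the stripes.\<close>
  then obtain N :: nat where N: "N > 0" "1 / N < \<delta>" by blast
  define G where "G = unit_cube d - sup_nbhd d \<delta> (Kp \<union> Km)"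
  have Gs: "G \<in> sets (borel_leb d)" and Gu: "G \<subseteq> unit_cube d"
    unfolding G_def using unit_cube_in_sets sup_nbhd_in_sets by auto
  have G_far: "\<exists>i<d. \<delta> \<le> \<bar>x i - y i\<bar>" if "x \<in> G" "y \<in> Kp \<union> Km" for x y
    using that unfolding G_def sup_nbhd_def by (auto simp: not_less)
  have G_disj: "Kp \<inter> G = {}" "Km \<inter> G = {}"
    using G_far \<delta>(1) by fastforce+
  have G_measure: "?\<mu> G > 1 - ?\<mu> Kp - ?\<mu> Km - m"
  proof -
    have "?\<mu> G = ?\<mu> (unit_cube d) - ?\<mu> (sup_nbhd d \<delta> (Kp \<union> Km))"
      unfolding G_def by (intro measurable_measure_Diff cube_fmeasurable unit_cube_in_cubes sup_nbhd_in_sets)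
        (auto simp: sup_nbhd_def)
    moreover have "?\<mu> (Kp \<union> Km) = ?\<mu> Kp + ?\<mu> Km"
      using measure_Un3[OF fin[OF Ks(1) sub(1)] fin[OF Ks(2) sub(2)]] disj by simp
    ultimately show ?thesis using \<eta>(2)[OF \<delta>(3)] by (simp add: measure_unit_cube)
  qed
  define Ap where "Ap = stripes N \<theta> 0"
  define Am where "Am = stripes N \<theta> (1 / 2)"
  have Ab: "Ap \<in> sets borel" "Am \<in> sets borel" by (auto simp: Ap_def Am_def stripes_borel)
  have Au: "Ap \<subseteq> {0..1}" "Am \<subseteq> {0..1}"
    unfolding Ap_def Am_def using \<theta> N(1) by (intro stripes_subset_unit; simp)+
  have A_measure: "measure lborel Ap = \<theta>" "measure lborel Am = \<theta>"
    unfolding Ap_def Am_def using \<theta> N(1) by (simp_all add: measure_def emeasure_stripes)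
  have A_gap: "(3 / 8) / N \<le> \<bar>t - u\<bar>" if "t \<in> Ap" "u \<in> Am" for t u
  proof -
    have "(3 / 8) / N \<le> (1 / 2 - \<theta>) / N" using \<theta> by (intro divide_right_mono) auto
    also have "\<dots> \<le> \<bar>t - u\<bar>" using stripes_gap[OF N(1)] that unfolding Ap_def Am_def .
    finally show ?thesis .
  qed
  have A_Icc: "measure lborel ({p..q} \<inter> Ap) \<le> \<theta> * (q - p) + \<theta> / N"
    "measure lborel ({p..q} \<inter> Am) \<le> \<theta> * (q - p) + \<theta> / N"
    if "0 \<le> p" "p \<le> q" "q \<le> 1" for p q
    unfolding Ap_def Am_def using \<theta> N(1) that by (auto intro!: measure_stripes_Int_interval_le)
  \<comment> \<open>The full cylinder over \<open>K\<close>, together with stripes over the set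
    \<open>G\<close> that keeps distance \<open>\<delta>\<close> from both compact sets.\<close>
  define E where "E K A = cylinder d K {0..1} \<union> cylinder d G A" for K A
  have Es: "E K A \<in> sets (borel_leb (Suc d))" if "K \<in> sets (borel_leb d)" "A \<in> sets borel" for K A
    unfolding E_def using that Gs by (intro sets.Un cylinder_in_sets) auto
  have Eu: "E K A \<subseteq> unit_cube (Suc d)" if "K \<subseteq> unit_cube d" "A \<subseteq> {0..1}" for K A
    unfolding E_def unit_cube_Suc using that Gu by (intro Un_least cylinder_mono) auto
  have E_measure: "?\<nu> (E K A) = ?\<mu> K + \<theta> * ?\<mu> G"
    if "K \<in> sets (borel_leb d)" "K \<subseteq> unit_cube d" "K \<inter> G = {}"
       "A \<in> sets borel" "A \<subseteq> {0..1}" "measure lborel A = \<theta>" for K A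
  proof -
    have "cylinder d K {0..1} \<in> fmeasurable (borel_leb (Suc d))"
      using that by (intro fin'[unfolded unit_cube_Suc] cylinder_in_sets cylinder_mono) auto
    moreover have "cylinder d G A \<in> fmeasurable (borel_leb (Suc d))"
      using that Gs Gu by (intro fin'[unfolded unit_cube_Suc] cylinder_in_sets cylinder_mono) auto
    moreover have "cylinder d K {0..1} \<inter> cylinder d G A = {}"
      using that(3) unfolding cylinder_def by auto
    ultimately have "?\<nu> (E K A) = ?\<nu> (cylinder d K {0..1}) + ?\<nu> (cylinder d G A)"
      unfolding E_def by (simp add: measure_Un3)
    also have "\<dots> = ?\<mu> K + \<theta> * ?\<mu> G"
      using that Gs by (simp add: measure_cylinder)
    finally show ?thesis .
  qed
  define Ep Em where "Ep = E Kp Ap" and "Em = E Km Am"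
  have EEs: "Ep \<in> sets (borel_leb (Suc d))" "Em \<in> sets (borel_leb (Suc d))"
    unfolding Ep_def Em_def by (auto intro!: Es Ks Ab)
  have EEu: "Ep \<subseteq> unit_cube (Suc d)" "Em \<subseteq> unit_cube (Suc d)"
    unfolding Ep_def Em_def using Eu[OF sub(1) Au(1)] Eu[OF sub(2) Au(2)] by auto
  have "Ap \<inter> Am = {}" using A_gap N(1) by fastforce
  then have EEdisj: "Ep \<inter> Em = {}"
    unfolding Ep_def Em_def E_def cylinder_def using disj G_disj by blast
  have EE_measure: "?\<nu> Ep = ?\<mu> Kp + \<theta> * ?\<mu> G" "?\<nu> Em = ?\<mu> Km + \<theta> * ?\<mu> G"
    unfolding Ep_def Em_def
    using E_measure[OF Ks(1) sub(1) G_disj(1) Ab(1) Au(1) A_measure(1)]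
      E_measure[OF Ks(2) sub(2) G_disj(2) Ab(2) Au(2) A_measure(2)] by auto
  have "1 / 2 * measure (leb (Suc d)) (unit_cube (Suc d) - Ep - Em)
      < min (measure (leb (Suc d)) Ep) (measure (leb (Suc d)) Em)"
  proof -
    have "measure (leb (Suc d)) (unit_cube (Suc d) - Ep - Em) = 1 - ?\<nu> Ep - ?\<nu> Em"
      using leb_Diff_measure[OF unit_cube_in_cubes sets_leb[OF EEs(1)] sets_leb[OF EEs(2)] EEu EEdisj]
      by (simp add: measure_leb EEs unit_cube_in_sets measure_unit_cube)
    moreover have "s / 2 * (1 - ?\<mu> Kp - ?\<mu> Km - m) < s / 2 * ?\<mu> G"
      using G_measure s by (intro mult_strict_left_mono) auto
    moreover have "s / 2 * m \<le> m" using \<open>s \<le> 1 / 2\<close> \<open>m > 0\<close> by simp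
    ultimately show ?thesis
      unfolding measure_leb[OF EEs(1)] measure_leb[OF EEs(2)] EE_measure
      unfolding m_def \<theta>_def by (auto simp: min_def field_simps split: if_splits)
  qed
  then obtain W' where W': "W' \<in> cubes (Suc d)" "W' \<subseteq> unit_cube (Suc d)"
    "min (measure (leb (Suc d)) (Ep \<inter> W')) (measure (leb (Suc d)) (Em \<inter> W')) \<ge> s * measure (leb (Suc d)) W'"
    using JS unit_cube_in_cubes sets_leb[OF EEs(1)] sets_leb[OF EEs(2)] EEu EEdisj
    unfolding John_Stromberg_pair_def by metis
  obtain a l where l: "l > 0" and W'_eq: "W' = PiE {..<Suc d} (\<lambda>j. {a j .. a j + l})"
    and a: "\<And>j. j < Suc d \<Longrightarrow> 0 \<le> a j \<and> a j + l \<le> 1"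
    using subcubeE[OF W'(1,2)] by metis
  define W where "W = PiE {..<d} (\<lambda>j. {a j .. a j + l})"
  define I where "I = {a d .. a d + l}"
  have W'W: "W' = cylinder d W I" unfolding W'_eq W_def I_def by (rule PiE_Suc_cylinder)
  have W: "W \<in> cubes d" unfolding W_def cubes_def using l by blast
  have Wu: "W \<subseteq> unit_cube d"
    unfolding W_def unit_cube_def
  proof (rule PiE_mono)
    fix j assume "j \<in> {..<d}"
    then show "{a j .. a j + l} \<subseteq> {0..1}" using a[of j] by auto
  qed
  have Iu: "I \<subseteq> {0..1}" using a[of d] unfolding I_def by auto
  have Ws: "W \<in> sets (borel_leb d)" using W by (rule cube_in_sets)
  have Wpos: "?\<mu> W > 0" using measure_cube_pos[OF W] measure_leb[OF Ws] by simp
  have W's: "W' \<in> sets (borel_leb (Suc d))" using W'(1) by (rule cube_in_sets)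
  have Il: "measure lborel I = l" using l by (simp add: I_def)
  have Ib: "I \<in> sets borel" by (simp add: I_def)
  have W'm: "?\<nu> W' = ?\<mu> W * l" unfolding W'W using measure_cylinder[OF Ws Ib] Il by simp
  have dense: "s * (?\<mu> W * l) \<le> ?\<nu> (Ep \<inter> W')" "s * (?\<mu> W * l) \<le> ?\<nu> (Em \<inter> W')"
    using W'(3) EEs W's W'm by (auto simp: measure_leb)
  have diam: "\<bar>x i - y i\<bar> \<le> l" if "x \<in> W" "y \<in> W" "i < d" for x y i
  proof -
    have "x i \<in> {a i .. a i + l}" "y i \<in> {a i .. a i + l}"
      using that unfolding W_def by (meson PiE_mem lessThan_iff)+
    then show ?thesis unfolding atLeastAtMost_iff by linarith
  qed
  \<comment> \<open>The density found in \<open>W'\<close> is charged to the base set and to the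
    stripes, the latter estimated as if they extended over all of \<open>W\<close>.\<close>
  have split: "s * (?\<mu> W * l) \<le> ?\<mu> (K \<inter> W) * l + ?\<mu> W * measure lborel (I \<inter> A)"
    if "K \<in> sets (borel_leb d)" "A \<in> sets borel" "s * (?\<mu> W * l) \<le> ?\<nu> (E K A \<inter> W')" for K A
  proof -
    let ?L = "cylinder d (K \<inter> W) I" and ?R = "cylinder d W (I \<inter> A)"
    have LR: "?L \<in> sets (borel_leb (Suc d))" "?R \<in> sets (borel_leb (Suc d))"
      using that Ws Ib by (auto intro!: cylinder_in_sets)
    have "?\<nu> (E K A \<inter> W') \<le> ?\<nu> (?L \<union> ?R)"
    proof (rule measure_mono_fmeasurable)
      show "E K A \<inter> W' \<subseteq> ?L \<union> ?R" unfolding E_def W'W cylinder_def by auto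
      show "E K A \<inter> W' \<in> sets (borel_leb (Suc d))" using Es[OF that(1,2)] W's by auto
      have "?L \<subseteq> W'" "?R \<subseteq> W'" unfolding W'W by (intro cylinder_mono; blast)+
      then show "?L \<union> ?R \<in> fmeasurable (borel_leb (Suc d))"
        using LR W'(2) by (intro fin' sets.Un) auto
    qed
    also have "\<dots> \<le> ?\<nu> ?L + ?\<nu> ?R" using LR by (rule measure_Un_le)
    also have "\<dots> = ?\<mu> (K \<inter> W) * l + ?\<mu> W * measure lborel (I \<inter> A)"
      using that Ws Ib Il by (simp add: measure_cylinder)
    finally show ?thesis using that(3) by simp
  qed
  have split': "s * (?\<mu> W * l) \<le> ?\<mu> (Kp \<inter> W) * l + ?\<mu> W * measure lborel (I \<inter> Ap)"
    "s * (?\<mu> W * l) \<le> ?\<mu> (Km \<inter> W) * l + ?\<mu> W * measure lborel (I \<inter> Am)"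
    using split[OF Ks(1) Ab(1)] split[OF Ks(2) Ab(2)] dense unfolding Ep_def Em_def by auto
  have IA: "measure lborel (I \<inter> Ap) \<le> \<theta> * l + \<theta> / N" "measure lborel (I \<inter> Am) \<le> \<theta> * l + \<theta> / N"
    using A_Icc[of "a d" "a d + l"] a[of d] l unfolding I_def by auto
  \<comment> \<open>A cube \<open>W\<close> of smaller side cannot meet two of \<open>Kp\<close>,
    \<open>Km\<close> and \<open>G\<close>. As \<open>W'\<close> meets both \<open>Ep\<close> and
    \<open>Em\<close>, \<open>W\<close> meets only \<open>G\<close> among them, and only stripes can
    provide the density.\<close>
  have "\<delta> \<le> l"
  proof (rule ccontr)
    assume "\<not> \<delta> \<le> l"
    then have small: False if "x \<in> W" "y \<in> W" "\<exists>i<d. \<delta> \<le> \<bar>x i - y i\<bar>" for x y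
      using that diam[of x y] by fastforce
    have "0 < s * (?\<mu> W * l)" using s l Wpos by simp
    then have "?\<nu> (Ep \<inter> W') > 0" "?\<nu> (Em \<inter> W') > 0" using dense by linarith+
    then have "Ep \<inter> W' \<noteq> {}" "Em \<inter> W' \<noteq> {}" by auto
    then obtain u v where uv: "u \<in> Ep" "u \<in> W'" "v \<in> Em" "v \<in> W'" by blast
    define u' v' where "u' = restrict u {..<d}" and "v' = restrict v {..<d}"
    have uv': "u' \<in> W" "v' \<in> W" "u' \<in> Kp \<or> u' \<in> G \<and> u d \<in> I \<inter> Ap" "v' \<in> Km \<or> v' \<in> G \<and> v d \<in> I \<inter> Am"
      using uv unfolding Ep_def Em_def E_def W'W cylinder_def u'_def v'_def by auto
    have no_p: "Kp \<inter> W = {}"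
    proof -
      have False if x: "x \<in> Kp" "x \<in> W" for x
      proof (cases "v' \<in> Km")
        case True
        with \<delta>0(2)[OF x(1)] \<delta>(2) have "\<exists>i<d. \<delta> \<le> \<bar>x i - v' i\<bar>" by (meson order_trans)
        then show False using small[OF x(2) uv'(2)] by blast
      next
        case False
        then have "v' \<in> G" using uv'(4) by blast
        from G_far[OF this, of x] x(1) show False using small[OF uv'(2) x(2)] by blast
      qed
      then show ?thesis by blast
    qed
    have no_m: "Km \<inter> W = {}"
    proof -
      have False if x: "x \<in> Km" "x \<in> W" for x
      proof -
        have "u' \<in> G" using uv'(1,3) no_p by blast
        from G_far[OF this, of x] x(1) show False using small[OF uv'(1) x(2)] by blast
      qed
      then show ?thesis by blast
    qed
    have "u d \<in> I \<inter> Ap" "v d \<in> I \<inter> Am" using uv' no_p no_m by blast+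
    \<comment> \<open>\<open>I\<close> meets stripes of both phases and therefore spans a gap, so
      \<open>1 / N \<le> 8 / 3 * l\<close>. The stripe density is then at most
      \<open>\<theta> + 8 / 3 * \<theta>\<close>, short of \<open>s\<close>.\<close>
    then have "(3 / 8) / N \<le> l" using A_gap[of "u d" "v d"] unfolding I_def by auto
    then have "\<theta> * (1 / N) \<le> \<theta> * (8 / 3 * l)" using \<theta>(1) by (intro mult_left_mono) auto
    moreover have "\<theta> * (1 / N) = \<theta> / N" by simp
    ultimately have "measure lborel (I \<inter> Ap) \<le> \<theta> * l + \<theta> * (8 / 3 * l)" using IA(1) by linarith
    also have "\<dots> = 11 / 3 * \<theta> * l" by (simp add: algebra_simps)
    also have "\<dots> < s * l" unfolding \<theta>_def using s l by simp
    finally have "?\<mu> W * measure lborel (I \<inter> Ap) < ?\<mu> W * (s * l)"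
      using Wpos by (rule mult_strict_left_mono)
    then show False using split'(1) no_p by (simp add: algebra_simps)
  qed
  \<comment> \<open>Here \<open>1 / N < \<delta> \<le> l\<close>, so the rounding error is at most
    one more \<open>\<theta> * l\<close>.\<close>
  have "\<theta> * l + \<theta> / N \<le> s / 2 * l"
  proof -
    have "\<theta> * (1 / N) \<le> \<theta> * l" using N(2) \<open>\<delta> \<le> l\<close> \<theta>(1) by (intro mult_left_mono) auto
    moreover have "\<theta> * (1 / N) = \<theta> / N" by simp
    ultimately have "\<theta> * l + \<theta> / N \<le> 2 * (\<theta> * l)" by linarith
    also have "\<dots> = s / 2 * l" by (simp add: \<theta>_def)
    finally show ?thesis .
  qed
  have final: "s / 2 * ?\<mu> W \<le> ?\<mu> (K \<inter> W)"
    if "s * (?\<mu> W * l) \<le> ?\<mu> (K \<inter> W) * l + ?\<mu> W * measure lborel (I \<inter> A)"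
      "measure lborel (I \<inter> A) \<le> \<theta> * l + \<theta> / N" for K A
  proof -
    have "?\<mu> W * measure lborel (I \<inter> A) \<le> ?\<mu> W * (s / 2 * l)"
      by (intro mult_left_mono order_trans[OF that(2)] \<open>\<theta> * l + \<theta> / N \<le> s / 2 * l\<close>) simp
    with that(1) have "(s / 2 * ?\<mu> W) * l \<le> ?\<mu> (K \<inter> W) * l" by (simp add: algebra_simps)
    then show ?thesis using l by simp
  qed
  have "s / 2 * ?\<mu> W \<le> min (?\<mu> (Kp \<inter> W)) (?\<mu> (Km \<inter> W))"
    using final[OF split'(1) IA(1)] final[OF split'(2) IA(2)] by simp
  with W Wu show "\<exists>W\<in>cubes d. W \<subseteq> unit_cube d \<and> s / 2 * ?\<mu> W \<le> min (?\<mu> (Kp \<inter> W)) (?\<mu> (Km \<inter> W))"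
    by blast
qed

subsection \<open>The John-Nirenberg inequality\<close>

lemma set_integral_Markov:
  fixes g :: "'a \<Rightarrow> real"
  assumes "set_integrable M W g" "\<And>x. x \<in> W \<Longrightarrow> 0 \<le> g x"
    and A: "A \<in> fmeasurable M" "A \<subseteq> W" "\<And>x. x \<in> A \<Longrightarrow> t \<le> g x"
  shows "t * measure M A \<le> (LINT x:W|M. g x)"
proof -
  have "t * measure M A = (\<integral>x. t * indicator A x \<partial>M)"
    using A(1) by (simp add: Int_absorb2 fmeasurableD sets.sets_into_space)
  also have "\<dots> \<le> (LINT x:W|M. g x)"
    unfolding set_lebesgue_integral_def
  proof (rule integral_mono)
    show "integrable M (\<lambda>x. t * indicator A x)"
      using A(1) by (auto simp: fmeasurable_def)
    show "integrable M (\<lambda>x. indicator W x *\<^sub>R g x)"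
      using assms(1) by (simp add: set_integrable_def)
    fix x
    show "t * indicator A x \<le> indicator W x *\<^sub>R g x"
      using A(2,3) assms(2)[of x] by (auto simp: indicator_def)
  qed
  finally show ?thesis .
qed

text \<open>Set integrability controls \<open>f\<close> on \<open>Q\<close> only, so measurability
  is taken from the function that equals \<open>f\<close> on \<open>Q\<close> and 0
  elsewhere.\<close>

lemma level_set_in_sets:
  fixes f :: "'a \<Rightarrow> real"
  assumes "set_integrable M Q f" "Q \<in> sets M"
  shows "{x \<in> Q. c \<le> f x} \<in> sets M" "{x \<in> Q. f x \<le> c} \<in> sets M"
    "{x \<in> Q. c < f x} \<in> sets M"
proof -
  have m[measurable]: "(\<lambda>x. indicator Q x *\<^sub>R f x) \<in> borel_measurable M"
    using assms(1) unfolding set_integrable_def by (rule borel_measurable_integrable)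
  have *: "{x \<in> Q. f x \<in> B} \<in> sets M" if "B \<in> sets borel" for B
  proof -
    have "{x \<in> Q. f x \<in> B} = Q \<inter> ((\<lambda>x. indicator Q x *\<^sub>R f x) -` B \<inter> space M)"
      using sets.sets_into_space[OF assms(2)] by auto
    also have "\<dots> \<in> sets M"
      using assms(2) measurable_sets[OF m that] by auto
    finally show ?thesis .
  qed
  show "{x \<in> Q. c \<le> f x} \<in> sets M" "{x \<in> Q. f x \<le> c} \<in> sets M" "{x \<in> Q. c < f x} \<in> sets M"
    using *[of "{c..}"] *[of "{..c}"] *[of "{c<..}"] by auto
qed

lemma set_integrable_abs_diff_const:
  fixes f :: "'a \<Rightarrow> real"
  assumes "set_integrable M Q f" "W \<in> fmeasurable M" "W \<subseteq> Q"
  shows "set_integrable M W (\<lambda>x. \<bar>f x - c\<bar>)"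
proof -
  have "set_integrable M W f"
    using assms by (auto intro: set_integrable_subset)
  moreover have "set_integrable M W (\<lambda>_. c)"
    using assms(2) unfolding set_integrable_def fmeasurable_def by (auto intro: integrable_scaleR_left)
  ultimately show ?thesis
    by (intro set_integrable_abs set_integral_diff(1))
qed

text \<open>The bound \<open>2 * N\<close> on \<open>a - c0\<close> gives, by Markov, that at most
  half of \<open>Q\<close> lies above \<open>a\<close>; hence the upper level set is the smaller one
  in the John-Stromberg alternative. The oscillation hypothesis allows any constant
  \<open>c\<close>, so that it passes from \<open>f\<close> to \<open>- f\<close>.\<close>

lemma level_set_decay_step:
  assumes JS: "John_Stromberg_pair d (1 / 2) s" and Q: "Q \<in> cubes d"
    and f: "set_integrable (leb d) Q f" and "N > 0"
    and osc: "\<And>W. W \<in> cubes d \<Longrightarrow> W \<subseteq> Q \<Longrightarrow> \<exists>c. (LINT x:W|leb d. \<bar>f x - c\<bar>) \<le> N * measure (leb d) W"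
    and c0: "(LINT x:Q|leb d. \<bar>f x - c0\<bar>) \<le> N * measure (leb d) Q"
    and a: "c0 + 2 * N \<le> a"
  shows "measure (leb d) {x \<in> Q. a + 3 * N / s \<le> f x} \<le> 1 / 3 * measure (leb d) {x \<in> Q. a \<le> f x}"
proof -
  let ?\<mu> = "measure (leb d)"
  have s: "s > 0" using JS by (simp add: John_Stromberg_pair_def)
  define M where "M = 3 * N / s"
  have M: "M > 0" "s * M = 3 * N" using s \<open>N > 0\<close> by (auto simp: M_def)
  have Qs: "Q \<in> sets (leb d)" using Q sets_leb cube_in_sets by blast
  note lev = level_set_in_sets[OF f Qs]
  have fin: "A \<in> fmeasurable (leb d)" if "A \<in> sets (leb d)" "A \<subseteq> Q" for A
    using fmeasurableI2[OF cube_fmeasurable_leb[OF Q] that(2,1)] .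
  define Ep Em where "Ep = {x \<in> Q. a + M \<le> f x}" and "Em = {x \<in> Q. f x \<le> a}"
  have E: "Ep \<in> sets (leb d)" "Em \<in> sets (leb d)" "Ep \<subseteq> Q" "Em \<subseteq> Q"
    using lev unfolding Ep_def Em_def by auto
  have disj: "Ep \<inter> Em = {}" using M(1) unfolding Ep_def Em_def by auto
  have "\<not> min (?\<mu> Ep) (?\<mu> Em) > 1 / 2 * ?\<mu> (Q - Ep - Em)"
  proof
    assume "min (?\<mu> Ep) (?\<mu> Em) > 1 / 2 * ?\<mu> (Q - Ep - Em)"
    then obtain W where W: "W \<in> cubes d" "W \<subseteq> Q" "min (?\<mu> (Ep \<inter> W)) (?\<mu> (Em \<inter> W)) \<ge> s * ?\<mu> W"
      using JS Q E disj unfolding John_Stromberg_pair_def by metis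
    obtain c where c: "(LINT x:W|leb d. \<bar>f x - c\<bar>) \<le> N * ?\<mu> W" using osc W by blast
    have Wf: "W \<in> fmeasurable (leb d)" using cube_fmeasurable_leb[OF W(1)] .
    have Wpos: "?\<mu> W > 0" using measure_cube_pos[OF W(1)] .
    have "M / 2 * (s * ?\<mu> W) \<le> (LINT x:W|leb d. \<bar>f x - c\<bar>)"
    \<comment> \<open>Any \<open>c\<close> is at distance at least \<open>M / 2\<close> from all
      values of \<open>f\<close> on \<open>Ep\<close>, or from all values on
      \<open>Em\<close>.\<close>
    proof (cases "c \<le> a + M / 2")
      case True
      have "M / 2 * (s * ?\<mu> W) \<le> M / 2 * ?\<mu> (Ep \<inter> W)"
        using W(3) M(1) by (intro mult_left_mono) auto
      also have "\<dots> \<le> (LINT x:W|leb d. \<bar>f x - c\<bar>)"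
      proof (rule set_integral_Markov[OF set_integrable_abs_diff_const[OF f Wf W(2)]])
        show "Ep \<inter> W \<in> fmeasurable (leb d)" using E Wf by (intro fin) auto
        fix x assume "x \<in> Ep \<inter> W"
        then show "M / 2 \<le> \<bar>f x - c\<bar>" using True unfolding Ep_def mem_Collect_eq Int_iff by linarith
      qed auto
      finally show ?thesis .
    next
      case False
      have "M / 2 * (s * ?\<mu> W) \<le> M / 2 * ?\<mu> (Em \<inter> W)"
        using W(3) M(1) by (intro mult_left_mono) auto
      also have "\<dots> \<le> (LINT x:W|leb d. \<bar>f x - c\<bar>)"
      proof (rule set_integral_Markov[OF set_integrable_abs_diff_const[OF f Wf W(2)]])
        show "Em \<inter> W \<in> fmeasurable (leb d)" using E Wf by (intro fin) auto
        fix x assume "x \<in> Em \<inter> W"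
        then show "M / 2 \<le> \<bar>f x - c\<bar>" using False unfolding Em_def mem_Collect_eq Int_iff by linarith
      qed auto
      finally show ?thesis .
    qed
    moreover have "M / 2 * (s * ?\<mu> W) = (s * M) / 2 * ?\<mu> W" by simp
    ultimately have "3 / 2 * N * ?\<mu> W \<le> N * ?\<mu> W" using c unfolding M(2) by linarith
    then show False using Wpos \<open>N > 0\<close> by simp
  qed
  then have small: "min (?\<mu> Ep) (?\<mu> Em) \<le> 1 / 2 * (?\<mu> Q - ?\<mu> Ep - ?\<mu> Em)"
    unfolding leb_Diff_measure[OF Q E disj] not_less .
  have compl: "?\<mu> {x \<in> Q. a < f x} = ?\<mu> Q - ?\<mu> Em"
  proof -
    have "{x \<in> Q. a < f x} = Q - Em" unfolding Em_def by auto
    then show ?thesis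
      using measurable_measure_Diff[OF cube_fmeasurable_leb[OF Q] E(2,4)] by simp
  qed
  have "2 * N * ?\<mu> {x \<in> Q. a < f x} \<le> (LINT x:Q|leb d. \<bar>f x - c0\<bar>)"
    by (rule set_integral_Markov[OF set_integrable_abs_diff_const[OF f cube_fmeasurable_leb[OF Q]]])
       (use a lev in \<open>auto intro!: fin\<close>)
  with c0 have "N * (2 * ?\<mu> {x \<in> Q. a < f x}) \<le> N * ?\<mu> Q" by simp
  then have half: "2 * ?\<mu> {x \<in> Q. a < f x} \<le> ?\<mu> Q" using \<open>N > 0\<close> by simp
  \<comment> \<open>By \<open>half\<close> and \<open>compl\<close>,
    \<open>{x \<in> Q. a < f x}\<close> has at most the measure of \<open>Em\<close>, so the minimum
    in \<open>small\<close> is that of \<open>Ep\<close>. The remainder there is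
    \<open>{x \<in> Q. a < f x}\<close> without \<open>Ep\<close>, which gives the factor 3.\<close>
  have "?\<mu> Ep \<le> ?\<mu> {x \<in> Q. a < f x}"
    using M(1) lev unfolding Ep_def by (intro measure_mono_fmeasurable fin) auto
  with small compl half have "3 * ?\<mu> Ep \<le> ?\<mu> {x \<in> Q. a < f x}" by (auto simp: min_def split: if_splits)
  also have "\<dots> \<le> ?\<mu> {x \<in> Q. a \<le> f x}"
    using lev by (intro measure_mono_fmeasurable fin) auto
  finally show ?thesis unfolding Ep_def M_def by simp
qed

lemma level_set_decay:
  assumes JS: "John_Stromberg_pair d (1 / 2) s" and Q: "Q \<in> cubes d"
    and f: "set_integrable (leb d) Q f" and "N > 0"
    and osc: "\<And>W. W \<in> cubes d \<Longrightarrow> W \<subseteq> Q \<Longrightarrow> \<exists>c. (LINT x:W|leb d. \<bar>f x - c\<bar>) \<le> N * measure (leb d) W"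
    and c0: "(LINT x:Q|leb d. \<bar>f x - c0\<bar>) \<le> N * measure (leb d) Q"
  shows "measure (leb d) {x \<in> Q. c0 + 2 * N + real k * (3 * N / s) \<le> f x} \<le> (1 / 3) ^ k * measure (leb d) Q"
proof (induction k)
  case 0
  have Qs: "Q \<in> sets (leb d)" using Q sets_leb cube_in_sets by blast
  show ?case
    using level_set_in_sets[OF f Qs] by (simp add: measure_mono_fmeasurable cube_fmeasurable_leb[OF Q])
next
  case (Suc k)
  have s: "s > 0" using JS by (simp add: John_Stromberg_pair_def)
  let ?a = "c0 + 2 * N + real k * (3 * N / s)"
  have "c0 + 2 * N \<le> ?a" using s \<open>N > 0\<close> by simp
  from level_set_decay_step[OF JS Q f \<open>N > 0\<close> osc c0 this]
  have "measure (leb d) {x \<in> Q. ?a + 3 * N / s \<le> f x} \<le> 1 / 3 * measure (leb d) {x \<in> Q. ?a \<le> f x}" .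
  also have "\<dots> \<le> (1 / 3) ^ Suc k * measure (leb d) Q" using Suc.IH by simp
  also have "?a + 3 * N / s = c0 + 2 * N + real (Suc k) * (3 * N / s)" by (simp add: algebra_simps add_divide_distrib)
  finally show ?case .
qed

lemma bmo_normD:
  assumes "bmo_norm d Q f < \<infinity>" "W \<in> cubes d" "W \<subseteq> Q"
  shows "(LINT x:W|leb d. \<bar>f x - cube_mean d W f\<bar>) \<le> enn2real (bmo_norm d Q f) * measure (leb d) W"
proof -
  have "ennreal (cube_mean d W (\<lambda>x. \<bar>f x - cube_mean d W f\<bar>)) \<le> bmo_norm d Q f"
    unfolding bmo_norm_def using assms(2,3) by (intro SUP_upper) auto
  also have "\<dots> = ennreal (enn2real (bmo_norm d Q f))" using assms(1) by simp
  finally have "cube_mean d W (\<lambda>x. \<bar>f x - cube_mean d W f\<bar>) \<le> enn2real (bmo_norm d Q f)"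
    by (simp add: ennreal_le_iff)
  then show ?thesis
    using measure_cube_pos[OF assms(2)] by (simp add: cube_mean_def[of d W "\<lambda>x. \<bar>f x - cube_mean d W f\<bar>"] field_simps)
qed

text \<open>The decay is applied to \<open>f\<close> and to \<open>- f\<close>, whence the factor 2.
  With \<open>M = 3 * N / s\<close>, rounding down to whole steps of length \<open>M\<close> costs a
  factor e, and the initial offset \<open>2 * N\<close> costs
  \<open>exp (2 * s / 3)\<close>.\<close>

lemma question_JN_of_John_Stromberg_pair:
  assumes JS: "\<And>d. d \<ge> 1 \<Longrightarrow> John_Stromberg_pair d (1 / 2) s" and s: "s > 0"
  shows question_JN
  unfolding question_JN_def
proof (intro exI conjI allI impI ballI)
  show "2 * exp (1 + 2 * s / 3) > 0" by simp
  show "s / 3 > 0" using s by simp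
  fix d :: nat and Q and f :: "(nat \<Rightarrow> real) \<Rightarrow> real" and \<alpha> :: real
  assume "1 \<le> d" and Q: "Q \<in> cubes d" and "0 < \<alpha>"
    and f': "set_integrable (leb d) Q f \<and> 0 < bmo_norm d Q f \<and> bmo_norm d Q f < \<infinity>"
  let ?\<mu> = "measure (leb d)"
  define N where "N = enn2real (bmo_norm d Q f)"
  define M where "M = 3 * N / s"
  define c0 where "c0 = cube_mean d Q f"
  have f: "set_integrable (leb d) Q f" using f' by simp
  have "N > 0" unfolding N_def using f' by (simp add: enn2real_positive_iff)
  then have "M > 0" using s by (simp add: M_def)
  have osc: "(LINT x:W|leb d. \<bar>f x - cube_mean d W f\<bar>) \<le> N * ?\<mu> W" if "W \<in> cubes d" "W \<subseteq> Q" for W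
    unfolding N_def using bmo_normD that f' by blast
  have Qs: "Q \<in> sets (leb d)" using Q sets_leb cube_in_sets by blast
  have fin: "A \<in> fmeasurable (leb d)" if "A \<in> sets (leb d)" "A \<subseteq> Q" for A
    using fmeasurableI2[OF cube_fmeasurable_leb[OF Q] that(2,1)] .
  have neg: "set_integrable (leb d) Q (\<lambda>x. - f x)" using f unfolding set_integrable_def by simp
  have abs_neg: "\<bar>- f x - - c\<bar> = \<bar>f x - c\<bar>" for x c by simp
  have up: "?\<mu> {x \<in> Q. c0 + 2 * N + real k * M \<le> f x} \<le> (1 / 3) ^ k * ?\<mu> Q" for k
    unfolding M_def
    by (rule level_set_decay[OF JS[OF \<open>1 \<le> d\<close>] Q f \<open>N > 0\<close>]) (use osc Q in \<open>auto simp: c0_def\<close>)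
  have down: "?\<mu> {x \<in> Q. - c0 + 2 * N + real k * M \<le> - f x} \<le> (1 / 3) ^ k * ?\<mu> Q" for k
    unfolding M_def
  proof (rule level_set_decay[OF JS[OF \<open>1 \<le> d\<close>] Q neg \<open>N > 0\<close>])
    show "(LINT x:Q|leb d. \<bar>- f x - - c0\<bar>) \<le> N * ?\<mu> Q"
      unfolding abs_neg c0_def using osc Q by simp
    show "\<exists>c. (LINT x:W|leb d. \<bar>- f x - c\<bar>) \<le> N * ?\<mu> W" if "W \<in> cubes d" "W \<subseteq> Q" for W
      by (rule exI[of _ "- cube_mean d W f"]) (unfold abs_neg, rule osc[OF that])
  qed
  have eM: "s / 3 * \<alpha> / N = \<alpha> / M" "2 * s / 3 = 2 * N / M"
    using \<open>N > 0\<close> s by (auto simp: M_def field_simps)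
  have goal_exp: "2 * exp (1 + 2 * s / 3) * ?\<mu> Q * exp (- (s / 3) * \<alpha> / N) = 2 * exp (1 - (\<alpha> - 2 * N) / M) * ?\<mu> Q"
  proof -
    have "1 - (\<alpha> - 2 * N) / M = (1 + 2 * s / 3) + (- (s / 3) * \<alpha> / N)"
      using eM by (simp add: diff_divide_distrib)
    then show ?thesis by (simp only: exp_add) simp
  qed
  define A where "A = {x \<in> Q. \<alpha> < \<bar>f x - c0\<bar>}"
  have A: "A \<in> sets (leb d)"
  proof -
    have "A = {x \<in> Q. c0 + \<alpha> < f x} \<union> {x \<in> Q. - c0 + \<alpha> < - f x}"
      unfolding A_def by auto
    then show ?thesis using level_set_in_sets(3)[OF f Qs] level_set_in_sets(3)[OF neg Qs] by simp
  qed
  have "?\<mu> A \<le> 2 * exp (1 - (\<alpha> - 2 * N) / M) * ?\<mu> Q"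
  proof (cases "\<alpha> < 2 * N")
    \<comment> \<open>Below the offset the claimed bound already exceeds the measure of
      \<open>Q\<close>.\<close>
    case True
    have "?\<mu> A \<le> 1 * ?\<mu> Q"
      using A cube_fmeasurable_leb[OF Q] by (auto intro!: measure_mono_fmeasurable simp: A_def)
    also have "\<dots> \<le> 2 * exp (1 - (\<alpha> - 2 * N) / M) * ?\<mu> Q"
    proof (rule mult_right_mono)
      have "(\<alpha> - 2 * N) / M \<le> 0" using True \<open>M > 0\<close> by (simp add: divide_nonpos_pos)
      then have "1 \<le> exp (1 - (\<alpha> - 2 * N) / M)" by simp
      then show "1 \<le> 2 * exp (1 - (\<alpha> - 2 * N) / M)" by linarith
    qed simp
    finally show ?thesis .
  next
    case False
    \<comment> \<open>The number of whole steps of length \<open>M\<close> between the offset and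
      \<open>\<alpha>\<close>.\<close>
    define k where "k = nat \<lfloor>(\<alpha> - 2 * N) / M\<rfloor>"
    have "0 \<le> (\<alpha> - 2 * N) / M" using False \<open>M > 0\<close> by simp
    then have k: "real k \<le> (\<alpha> - 2 * N) / M" "(\<alpha> - 2 * N) / M \<le> real k + 1"
      unfolding k_def by linarith+
    from k(1) have kM: "2 * N + real k * M \<le> \<alpha>" using \<open>M > 0\<close> by (simp add: field_simps)
    let ?U = "{x \<in> Q. c0 + 2 * N + real k * M \<le> f x}" and ?V = "{x \<in> Q. - c0 + 2 * N + real k * M \<le> - f x}"
    have UV: "?U \<in> sets (leb d)" "?V \<in> sets (leb d)"
      using level_set_in_sets(1)[OF f Qs] level_set_in_sets(1)[OF neg Qs] by auto
    have "A \<subseteq> ?U \<union> ?V" using kM unfolding A_def by auto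
    then have "?\<mu> A \<le> ?\<mu> (?U \<union> ?V)"
      using A UV by (intro measure_mono_fmeasurable fin) auto
    also have "\<dots> \<le> ?\<mu> ?U + ?\<mu> ?V" using UV by (rule measure_Un_le)
    also have "\<dots> \<le> 2 * (1 / 3) ^ k * ?\<mu> Q" using up[of k] down[of k] by simp
    also have "\<dots> \<le> 2 * exp (1 - (\<alpha> - 2 * N) / M) * ?\<mu> Q"
    proof (intro mult_right_mono mult_left_mono)
      \<comment> \<open>As e is at most 3, decay by a factor 3 per step is at least exponential with
        rate 1.\<close>
      have "1 / 3 \<le> exp (- 1 :: real)" using exp_le by (simp add: exp_minus field_simps)
      then have "(1 / 3) ^ k \<le> exp (- 1 :: real) ^ k" by (intro power_mono) auto
      also have "\<dots> = exp (- real k)" by (simp add: exp_of_nat_mult[symmetric])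
      also have "\<dots> \<le> exp (1 - (\<alpha> - 2 * N) / M)" using k(2) by simp
      finally show "(1 / 3) ^ k \<le> exp (1 - (\<alpha> - 2 * N) / M)" .
    qed simp_all
    finally show ?thesis .
  qed
  then show "?\<mu> {x \<in> Q. \<bar>f x - cube_mean d Q f\<bar> > \<alpha>}
      \<le> 2 * exp (1 + 2 * s / 3) * ?\<mu> Q * exp (- (s / 3) * \<alpha> / enn2real (bmo_norm d Q f))"
    unfolding A_def c0_def N_def[symmetric] goal_exp .
qed

subsection \<open>The equivalences\<close>

text \<open>The constants of the two sides may differ: passing from multi-cubes to measurable sets
  halves \<open>s\<close>, while the converse specialises to the unit cube and keeps it.\<close>

lemma question_A_half_iff: "question_A_half \<longleftrightarrow> (\<exists>s>0. \<forall>d\<ge>1. John_Stromberg_pair d (1 / 2) s)"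
proof
  assume question_A_half
  then obtain s where s: "s > 0" and
    H: "\<And>d Ep Em. d \<ge> 1 \<Longrightarrow> multi_cube d Ep \<Longrightarrow> multi_cube d Em \<Longrightarrow> Ep \<inter> Em = {} \<Longrightarrow>
      min (measure (leb d) Ep) (measure (leb d) Em) > 1 / 2 * (1 - measure (leb d) Ep - measure (leb d) Em) \<Longrightarrow>
      \<exists>W\<in>cubes d. W \<subseteq> unit_cube d \<and>
        min (measure (leb d) (W \<inter> Ep)) (measure (leb d) (W \<inter> Em)) \<ge> s * measure (leb d) W"
    unfolding question_A_half_def by metis
  have "John_Stromberg_pair d (1 / 2) (s / 2)" if "d \<ge> 1" for d
    using s H[OF that] by (rule John_Stromberg_pair_of_multi_cubes) simp_all
  then show "\<exists>s>0. \<forall>d\<ge>1. John_Stromberg_pair d (1 / 2) s"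
    using s by (intro exI[of _ "s / 2"]) auto
next
  assume "\<exists>s>0. \<forall>d\<ge>1. John_Stromberg_pair d (1 / 2) s"
  then obtain s where s: "s > 0" and JS: "\<And>d. d \<ge> 1 \<Longrightarrow> John_Stromberg_pair d (1 / 2) s" by auto
  show question_A_half
    unfolding question_A_half_def
  proof (intro exI[of _ s] conjI s allI impI; elim conjE)
    fix d :: nat and Ep Em
    assume d: "d \<ge> 1" and mc: "multi_cube d Ep" "multi_cube d Em" and disj: "Ep \<inter> Em = {}"
      and big: "min (measure (leb d) Ep) (measure (leb d) Em)
        > 1 / 2 * (1 - measure (leb d) Ep - measure (leb d) Em)"
    have E: "Ep \<in> sets (leb d)" "Em \<in> sets (leb d)" "Ep \<subseteq> unit_cube d" "Em \<subseteq> unit_cube d"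
      using mc[THEN multi_cube_in_sets, THEN sets_leb] mc unfolding multi_cube_def by auto
    have "measure (leb d) (unit_cube d - Ep - Em) = 1 - measure (leb d) Ep - measure (leb d) Em"
      using leb_Diff_measure[OF unit_cube_in_cubes E disj]
      by (simp add: measure_leb unit_cube_in_sets measure_unit_cube)
    with big JS[OF d] E disj unit_cube_in_cubes[of d]
    obtain W where "W \<in> cubes d" "W \<subseteq> unit_cube d"
        "min (measure (leb d) (Ep \<inter> W)) (measure (leb d) (Em \<inter> W)) \<ge> s * measure (leb d) W"
      unfolding John_Stromberg_pair_def by metis
    then show "\<exists>W\<in>cubes d. W \<subseteq> unit_cube d \<and>
        min (measure (leb d) (W \<inter> Ep)) (measure (leb d) (W \<inter> Em)) \<ge> s * measure (leb d) W"
      unfolding Int_commute[of Ep] Int_commute[of Em] by blast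
  qed
qed

text \<open>The constant \<open>(1 - s) / 2\<close> obtained above is at most the stated one, since
  \<open>(1 - s) * (2 - 2 * s) \<le> 2 - 3 * s\<close> amounts to \<open>2 * s * s \<le> s\<close>.
  Monotonicity in the first constant then applies.\<close>

lemma John_Stromberg_pair_improved:
  assumes JS: "\<And>d. d \<ge> 1 \<Longrightarrow> John_Stromberg_pair d (1 / 2) s"
  shows "s \<le> 1 / 2" "John_Stromberg_pair d (1 / 2 * ((2 - 3 * s) / (2 - 2 * s))) (s / 2)"
proof -
  show le: "s \<le> 1 / 2" using John_Stromberg_pair_density_le_half[of 0] JS[of "Suc 0"] by simp
  have "s > 0" using JS[of 1] by (simp add: John_Stromberg_pair_def)
  have "s * (2 * s) \<le> s * 1" using le \<open>s > 0\<close> by (intro mult_left_mono) auto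
  then have "(1 - s) * (2 - 2 * s) \<le> 2 - 3 * s" by (simp add: algebra_simps)
  then have "1 - s \<le> (2 - 3 * s) / (2 - 2 * s)" using le by (simp add: pos_le_divide_eq)
  from mult_left_mono[OF this, of "1 / 2"]
  have "(1 - s) / 2 \<le> 1 / 2 * ((2 - 3 * s) / (2 - 2 * s))" by simp
  \<comment> \<open>The pair in dimension \<open>Suc d\<close> yields the improved pair in dimension
    \<open>d\<close>.\<close>
  moreover have "John_Stromberg_pair d ((1 - s) / 2) (s / 2)"
    using JS le by (intro John_Stromberg_pair_improve) auto
  ultimately show "John_Stromberg_pair d (1 / 2 * ((2 - 3 * s) / (2 - 2 * s))) (s / 2)"
    by (rule John_Stromberg_pair_mono[rotated])
qed

lemma question_A_of_question_A_tau_s: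
  assumes question_A_tau_s
  shows question_A
proof -
  obtain \<tau> s where \<tau>s: "0 < \<tau>" "\<tau> < 1 / 2" "s > 0"
    and JS: "\<And>d. d \<ge> 1 \<Longrightarrow> John_Stromberg_pair d \<tau> s"
    using assms unfolding question_A_tau_s_def by blast
  show ?thesis
    unfolding question_A_def
  proof (rule exI[of _ \<tau>], rule exI[of _ s], intro conjI \<tau>s allI ballI impI)
    fix d :: nat and Q Ep Em
    assume "d \<ge> 1" "Q \<in> cubes d" "Ep \<in> sets (leb d)" "Em \<in> sets (leb d)"
      "Ep \<subseteq> Q \<and> Em \<subseteq> Q \<and> Ep \<inter> Em = {} \<and>
       min (measure (leb d) Ep) (measure (leb d) Em) > \<tau> * measure (leb d) (Q - Ep - Em)"
    then obtain W where "W \<in> cubes d" "W \<subseteq> Q"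
      "min (measure (leb d) (Ep \<inter> W)) (measure (leb d) (Em \<inter> W)) \<ge> s * measure (leb d) W"
      using JS[of d] unfolding John_Stromberg_pair_def by metis
    then show "\<exists>W\<in>cubes d. W \<subseteq> Q \<and>
        min (measure (leb d) (W \<inter> Ep)) (measure (leb d) (W \<inter> Em)) \<ge> s * measure (leb d) W"
      unfolding Int_commute[of Ep] Int_commute[of Em] by blast
  qed
qed

text \<open>The first conjunct identifies the question on multi-cubes with the existence of a common
  pair. As the constants may change in this passage, the improvement is stated for every
  \<open>s\<close> that forms a pair in all dimensions.\<close>

theorem corollary4p2:
  "(question_A_half \<longleftrightarrow> (\<exists>s>0. \<forall>d\<ge>1. John_Stromberg_pair d (1 / 2) s)) \<and>
   (question_A_half \<longrightarrow>
      (\<forall>s>0. (\<forall>d\<ge>1. John_Stromberg_pair d (1 / 2) s) \<longrightarrow>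
         (\<forall>d\<ge>1. John_Stromberg_pair d (1 / 2 * ((2 - 3 * s) / (2 - 2 * s))) (s / 2))) \<and>
      question_A_tau_s \<and> question_A \<and> question_JN)"
proof (intro conjI impI question_A_half_iff)
  show "\<forall>s>0. (\<forall>d\<ge>1. John_Stromberg_pair d (1 / 2) s) \<longrightarrow>
         (\<forall>d\<ge>1. John_Stromberg_pair d (1 / 2 * ((2 - 3 * s) / (2 - 2 * s))) (s / 2))"
    using John_Stromberg_pair_improved(2) by blast
  assume question_A_half
  then obtain s where s: "s > 0" and JS: "\<And>d. d \<ge> 1 \<Longrightarrow> John_Stromberg_pair d (1 / 2) s"
    unfolding question_A_half_iff by auto
  note improved = John_Stromberg_pair_improved[OF JS]
  show A_tau_s: question_A_tau_s
    unfolding question_A_tau_s_def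
  proof (intro exI conjI)
    \<comment> \<open>Positivity of the first constant is part of being a John-Stromberg
      pair.\<close>
    show "0 < 1 / 2 * ((2 - 3 * s) / (2 - 2 * s))"
      using improved(2)[of 1] by (simp add: John_Stromberg_pair_def)
    \<comment> \<open>The numerator is smaller than the denominator because \<open>s > 0\<close>,
      and the denominator is positive because \<open>s \<le> 1 / 2\<close>.\<close>
    show "1 / 2 * ((2 - 3 * s) / (2 - 2 * s)) < 1 / 2"
      using improved(1) s by (simp add: divide_less_eq)
    show "s / 2 > 0" using s by simp
    show "\<forall>d\<ge>1. John_Stromberg_pair d (1 / 2 * ((2 - 3 * s) / (2 - 2 * s))) (s / 2)"
      using improved(2) by blast
  qed
  show question_A using A_tau_s by (rule question_A_of_question_A_tau_s)
  show question_JN using JS s by (rule question_JN_of_John_Stromberg_pair)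
qed

end
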